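(* Let $\pi,\sigma$ be permutations of $\mathbb{N}_0$. Suppose $\pi$ dyadically differs from $\sigma$ by $f$, that is, $f(u)=\pi(u)\oplus\sigma(u)$ for $u\in\mathbb{N}_0$, and let $f_n^*=\max_{u\in[2^n]}f(u)$. If $f$ and $\#A_n^\pi$ satisfy $$\liminf_{n\to\infty}8^{-n}\,\#A_n^\pi\,f_n^*=0,$$ then, for all $p\in(1,\infty)$ with $p\ne2$, the systems $(e_k)_{k\ge0}$ and $(w_{\sigma(k)})_{k\ge0}$ are not equivalent in $L_p$. This is in particular the case if $\pi$ is dyadically linear and $f$ satisfies $f_n^*=o\left(\frac{4^n}{3^n}\right)$ as $n\to\infty$.
   Context: $\mathbb{N}_0=\{0,1,2,\ldots\}$ and $[m]=\{0,1,\ldots,m-1\}$; $\#A$ is the cardinality of $A$. For $m,n\in\mathbb{N}_0$ with binary expansions $m=\sum_{i\ge0} m_i2^i$ and $n=\sum_{i\ge0} n_i2^i$, $m_i,n_i\in\{0,1\}$, the dyadic sum is $m\oplus n=\sum_{i\ge 0}|m_i-n_i|2^i$ (bitwise XOR). On $[0,1]$, $e_n(t)=\exp(2\pi i n t)$; $r_0,r_1,\ldots$ are the Rademacher functions ($r_i(t)=\operatorname{sign}\sin(2^{i+1}\pi t)$), and $w_n=\prod_{i\ge 0} r_i^{n_i}$ is the $n$-th Walsh function. Two systems $(a_k)_{k\ge0}$, $(b_k)_{k\ge0}$ in $L_p[0,1]$ are equivalent in $L_p$ if there is $c>0$ such that $\frac1c\|\sum_k\xi_k a_k\|_p\le\|\sum_k\xi_k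 b_k\|_p\le c\|\sum_k\xi_k a_k\|_p$ for all complex sequences $(\xi_k)_{k\ge0}$ with only finitely many nonzero terms; $\|\cdot\|_p$ is the norm of $L_p[0,1]$. A permutation $\pi$ of $\mathbb{N}_0$ is dyadically linear if $\pi(m\oplus n)=\pi(m)\oplus\pi(n)$ for all $m,n\in\mathbb{N}_0$. For a permutation $\pi$ of $\mathbb{N}_0$, $A^\pi_n=\{(x,y,z)\in[2^n]^3 : x+y-z\in[2^n],\ \pi(x)\oplus\pi(y)\oplus\pi(z)=\pi(x+y-z)\}$. *)

theory Defs
  imports "HOL-Analysis.Analysis" "HOL-Library.Landau_Symbols"
begin

abbreviation dyadic_sum :: "nat \<Rightarrow> nat \<Rightarrow> nat"  (infixl "\<oplus>" 65)
  where "m \<oplus> n \<equiv> Bit_Operations.xor m n"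

definition trigonometric :: "nat \<Rightarrow> real \<Rightarrow> complex" where
  "trigonometric n t = exp (2 * of_real pi * \<i> * of_nat n * of_real t)"

definition rademacher :: "nat \<Rightarrow> real \<Rightarrow> real" where
  "rademacher i t = sgn (sin (2 ^ (i + 1) * pi * t))"

text \<open>The factors r_i ^ n_i with n_i = 0 equal 1, so the product ranges over the
  finite set of positions i at which the binary digit n_i is 1.\<close>

definition walsh :: "nat \<Rightarrow> real \<Rightarrow> real" where
  "walsh n t = (\<Prod>i | bit n i. rademacher i t)"

text \<open>This is the norm of L_p[0,1] only for measurable functions with integrable p-th power
  (the Bochner integral of a non-integrable function is 0).  It is applied below to
  finite linear combinations of bounded Borel functions.\<close>

definition Lp_norm :: "real \<Rightarrow> (real \<Rightarrow> complex) \<Rightarrow> real" where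
  "Lp_norm p g = (LINT t:{0..1}|lborel. cmod (g t) powr p) powr (1 / p)"

definition equivalent_in_Lp ::
    "real \<Rightarrow> (nat \<Rightarrow> real \<Rightarrow> complex) \<Rightarrow> (nat \<Rightarrow> real \<Rightarrow> complex) \<Rightarrow> bool" where
  "equivalent_in_Lp p a b \<longleftrightarrow>
     (\<exists>c>0. \<forall>\<xi> :: nat \<Rightarrow> complex. finite {k. \<xi> k \<noteq> 0} \<longrightarrow>
        1 / c * Lp_norm p (\<lambda>t. \<Sum>k | \<xi> k \<noteq> 0. \<xi> k * a k t)
          \<le> Lp_norm p (\<lambda>t. \<Sum>k | \<xi> k \<noteq> 0. \<xi> k * b k t) \<and>
        Lp_norm p (\<lambda>t. \<Sum>k | \<xi> k \<noteq> 0. \<xi> k * b k t)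
          \<le> c * Lp_norm p (\<lambda>t. \<Sum>k | \<xi> k \<noteq> 0. \<xi> k * a k t))"

definition dyadically_linear :: "(nat \<Rightarrow> nat) \<Rightarrow> bool" where
  "dyadically_linear \<pi> \<longleftrightarrow> (\<forall>m n. \<pi> (m \<oplus> n) = \<pi> m \<oplus> \<pi> n)"

definition dyadically_differs_by ::
    "(nat \<Rightarrow> nat) \<Rightarrow> (nat \<Rightarrow> nat) \<Rightarrow> (nat \<Rightarrow> nat) \<Rightarrow> bool" where
  "dyadically_differs_by \<pi> \<sigma> f \<longleftrightarrow> (\<forall>u. f u = \<pi> u \<oplus> \<sigma> u)"

text \<open>The condition z \<le> x + y expresses that x + y - z, taken in the integers, is
  nonnegative; subtraction on the natural numbers would truncate.\<close>

definition A_set :: "(nat \<Rightarrow> nat) \<Rightarrow> nat \<Rightarrow> (nat \<times> nat \<times> nat) set" where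
  "A_set \<pi> n = {(x, y, z). x < 2 ^ n \<and> y < 2 ^ n \<and> z < 2 ^ n \<and>
      z \<le> x + y \<and> x + y - z < 2 ^ n \<and>
      \<pi> x \<oplus> \<pi> y \<oplus> \<pi> z = \<pi> (x + y - z)}"

definition dyadic_max :: "(nat \<Rightarrow> nat) \<Rightarrow> nat \<Rightarrow> nat" where
  "dyadic_max f n = Max (f ` {..<2 ^ n})"

end

theory Submission
  imports Defs "HOL-Library.Z2" "HOL-Library.Function_Algebras"
begin

text \<open>
  Non-equivalence rests on two opposing facts about the inverse \<open>\<tau>\<close> of \<open>\<sigma>\<close> and the number of
  quadruples below \<open>N = 2 ^ n\<close> with both \<open>\<tau> i + \<tau> j = \<tau> k + \<tau> l\<close> and \<open>i \<oplus> j = k \<oplus> l\<close>.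

  \<^item> Equivalence produces many of them. The translated Walsh kernel
    \<open>\<Sum>j<N. w\<^sub>j(s) w\<^sub>j\<close> is \<open>N\<close> on an interval of length \<open>1/N\<close> and 0 elsewhere. Hence, for every
    translation \<open>s\<close>, the sum \<open>\<Sum>j<N. w\<^sub>j(s) e\<^bsub>\<tau>(j)\<^esub>\<close> has \<open>p\<close>-th moment comparable to
    \<open>N powr (p - 1)\<close>, just as its second moment is \<open>N\<close> by orthogonality. For \<open>p \<noteq> 2\<close> this forces
    the sum to have size comparable to \<open>N\<close> on a set of measure comparable to \<open>1/N\<close>, so that its
    fourth moment is at least \<open>\<kappa> N ^ 3\<close> (\<open>fourth_moment_lower_bound\<close>). The average of the fourth
    moment over \<open>s\<close> is the number of quadruples (\<open>sum_integral_twisted_sum_fourth_power\<close>).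

  \<^item> Injectivity of \<open>\<tau>\<close> allows only \<open>o(N ^ 3)\<close> of them (\<open>few_common_additive_quadruples\<close>). They are
    the additive quadruples of the graph \<open>\<Gamma> = {(\<tau> j, j) | j < N}\<close> in the product of the integers
    with a group of exponent two. If there were \<open>\<kappa> N ^ 3\<close>, the theorem of Balog, Szemeredi and
    Gowers would give a subset \<open>A\<close> of size proportional to \<open>N\<close> with only \<open>O(N)\<close> differences, and
    consequently only \<open>O(N)\<close> elements of the form \<open>a + 2(b\<^sub>0 - b)\<close>, for \<open>a\<close> in \<open>A\<close> and \<open>b\<close> in half
    of \<open>A\<close>. But doubling annihilates the second coordinate, so that such an element determines
    first \<open>a\<close> and then \<open>b\<close>, and there are of order \<open>N ^ 2\<close> of them.

  For the dyadically linear case, \<open>x \<oplus> y \<oplus> z = x + y - z\<close> is a condition on each binary digit that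
  six of the eight digit patterns meet. So \<open>A_set \<pi> n\<close> has at most \<open>6 ^ n\<close> elements, and the quantity
  in the limit inferior is at most \<open>(3/4) ^ n\<close> times the maximum of \<open>f\<close>, which tends to 0.
\<close>

section \<open>Walks in dense graphs\<close>

lemma card_times_fibre_le:
  fixes m :: real
  assumes "finite T" "finite X" and fib: "\<And>x. x \<in> X \<Longrightarrow> m \<le> card {t \<in> T. F t = x}"
  shows "card X * m \<le> card T"
proof -
  have "card X * m = (\<Sum>x\<in>X. m)" by simp
  also have "\<dots> \<le> (\<Sum>x\<in>X. real (card {t \<in> T. F t = x}))"
    by (intro sum_mono fib)
  also have "\<dots> = card (\<Union>x\<in>X. {t \<in> T. F t = x})"
    by (subst card_UN_disjoint) (use assms in \<open>auto\<close>)
  also have "\<dots> \<le> card T"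
    by (intro of_nat_mono card_mono) (use assms in auto)
  finally show ?thesis .
qed

text \<open>Dependent random choice. In the neighbourhood of a random vertex most pairs of vertices have
many common neighbours, because a pair with few common neighbours lies in few neighbourhoods.
Discarding the vertices that belong to many bad pairs leaves a set \<open>A\<close> such that, for any
\<open>a\<close>, \<open>a'\<close> in \<open>A\<close>, half of the vertices \<open>b\<close> of the neighbourhood have many common neighbours both
with \<open>a\<close> and with \<open>a'\<close>; these supply the walks of length four. The gain over pairs of neighbours is that \<^emph>\<open>every\<close>
pair of vertices of \<open>A\<close> is joined by a positive proportion of all conceivable walks.\<close>
lemma dense_graph_many_walks:
  fixes R :: "('a \<times> 'a) set" and \<delta> :: real
  defines "\<theta> \<equiv> \<delta>\<^sup>2 / 16"
  assumes V: "finite V" and R: "R \<subseteq> V \<times> V" "sym R" and \<delta>: "\<delta> > 0"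
    and dense: "card R \<ge> \<delta> * real (card V) ^ 2"
  obtains A where "A \<subseteq> V" "card A \<ge> \<delta> / 4 * card V"
    "\<And>a a'. a \<in> A \<Longrightarrow> a' \<in> A \<Longrightarrow>
       card {(x, b, y). (a, x) \<in> R \<and> (x, b) \<in> R \<and> (b, y) \<in> R \<and> (y, a') \<in> R}
         \<ge> \<delta> / 4 * \<theta>\<^sup>2 * real (card V) ^ 3"
proof (cases "V = {}")
  case True
  then show ?thesis using that[of "{}"] by auto
next
  case False
  define N where "N = real (card V)"
  have N: "N > 0" using False V by (simp add: N_def card_gt_0_iff)
  have \<theta>: "\<theta> > 0" using \<delta> by (simp add: \<theta>_def)
  have symR: "(x, y) \<in> R \<longleftrightarrow> (y, x) \<in> R" for x y using R(2) by (auto dest: symD)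
  have inV: "x \<in> V" "y \<in> V" if "(x, y) \<in> R" for x y using that R(1) by auto
  define Nb where "Nb v = {a. (v, a) \<in> R}" for v
  have Nb: "Nb v \<subseteq> V" "finite (Nb v)" for v
    using R(1) V by (auto simp: Nb_def intro: finite_subset)
  define bad where "bad = {(a, b) \<in> V \<times> V. card (Nb a \<inter> Nb b) < \<theta> * N}"
  have fbad: "finite bad" unfolding bad_def by (rule finite_subset[of _ "V \<times> V"]) (use V in auto)
  define Bv where "Bv v = bad \<inter> Nb v \<times> Nb v" for v
  have deg: "(\<Sum>v\<in>V. real (card (Nb v))) = card R"
  proof -
    have "R = Sigma V Nb" using R(1) by (auto simp: Nb_def)
    then show ?thesis using V Nb by (simp add: card_SigmaI)
  qed
  have cs: "\<delta>\<^sup>2 * N ^ 3 \<le> (\<Sum>v\<in>V. real (card (Nb v)) ^ 2)"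
  proof -
    have "(\<delta> * N\<^sup>2)\<^sup>2 \<le> (card R)\<^sup>2"
      using dense \<delta> N by (simp add: N_def power_mono)
    also have "\<dots> \<le> (\<Sum>v\<in>V. real (card (Nb v)) ^ 2) * N"
      using Cauchy_Schwarz_ineq_sum[of "\<lambda>v. real (card (Nb v))" "\<lambda>_. 1" V] deg
      by (simp add: N_def)
    finally have "(\<delta>\<^sup>2 * N ^ 3) * N \<le> (\<Sum>v\<in>V. real (card (Nb v)) ^ 2) * N"
      by (simp add: power2_eq_square power3_eq_cube algebra_simps)
    then show ?thesis using N by simp
  qed
  have badsum: "(\<Sum>v\<in>V. real (card (Bv v))) \<le> \<theta> * N ^ 3"
  proof -
    have "(\<Sum>v\<in>V. real (card (Bv v))) = card (Sigma V Bv)"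
      using V fbad by (simp add: card_SigmaI Bv_def)
    also have "\<dots> = card (Sigma bad (\<lambda>(a,b). Nb a \<inter> Nb b))"
      by (rule arg_cong[where f=real], rule bij_betw_same_card[where f="\<lambda>(v,p). (p,v)"], rule bij_betwI[where g="\<lambda>(p,v). (v,p)"])
         (use symR inV in \<open>auto simp: Bv_def Nb_def\<close>)
    also have "\<dots> = (\<Sum>p\<in>bad. real (card (case p of (a,b) \<Rightarrow> Nb a \<inter> Nb b)))"
      using fbad Nb by (subst card_SigmaI) auto
    also have "\<dots> \<le> (\<Sum>p\<in>bad. \<theta> * N)"
      by (rule sum_mono) (auto simp: bad_def)
    also have "\<dots> = card bad * (\<theta> * N)" by simp
    also have "\<dots> \<le> card (V \<times> V) * (\<theta> * N)"
      using \<theta> N V by (intro mult_right_mono of_nat_mono card_mono) (auto simp: bad_def)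
    also have "\<dots> = \<theta> * N ^ 3"
      by (simp add: N_def power3_eq_cube card_cartesian_product)
    finally show ?thesis .
  qed
  \<comment> \<open>The weight 8 makes at most an eighth of the pairs in the chosen neighbourhood bad,
    so that the vertices with more than a quarter of bad partners are at most half.\<close>
  have "\<exists>v\<in>V. real (card (Nb v)) ^ 2 - 8 * card (Bv v) \<ge> \<delta>\<^sup>2 / 2 * N\<^sup>2"
  proof (rule ccontr)
    assume "\<not> ?thesis"
    then have "(\<Sum>v\<in>V. real (card (Nb v)) ^ 2 - 8 * card (Bv v)) < (\<Sum>v\<in>V. \<delta>\<^sup>2 / 2 * N\<^sup>2)"
      using False V by (intro sum_strict_mono) auto
    also have "\<dots> = \<delta>\<^sup>2 / 2 * N ^ 3" by (simp add: N_def power3_eq_cube power2_eq_square)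
    also have "\<dots> = \<delta>\<^sup>2 * N ^ 3 - 8 * (\<theta> * N ^ 3)" by (simp add: \<theta>_def)
    also have "\<dots> \<le> (\<Sum>v\<in>V. real (card (Nb v)) ^ 2) - 8 * (\<Sum>v\<in>V. real (card (Bv v)))"
      using cs badsum by linarith
    finally show False by (simp add: sum_subtractf sum_distrib_left)
  qed
  then obtain v where v: "real (card (Nb v)) ^ 2 - 8 * card (Bv v) \<ge> \<delta>\<^sup>2 / 2 * N\<^sup>2" by blast
  define M where "M = real (card (Nb v))"
  have "M\<^sup>2 \<ge> \<delta>\<^sup>2 / 2 * N\<^sup>2" using v by (simp add: M_def)
  then have "(\<delta> / 2 * N)\<^sup>2 \<le> M\<^sup>2"
    by (simp add: power_mult_distrib power_divide) (smt (verit) zero_le_mult_iff zero_le_power2)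
  then have M: "M \<ge> \<delta> / 2 * N" by (rule power2_le_imp_le) (simp add: M_def)
  have Mpos: "M > 0" using M \<delta> N by (meson less_le_trans mult_pos_pos half_gt_zero)
  have badv: "card (Bv v) \<le> M\<^sup>2 / 8" using v \<delta> N
    by (simp add: M_def) (smt (verit) zero_le_mult_iff zero_le_power2)
  define bp where "bp a = {b \<in> Nb v. (a, b) \<in> bad}" for a
  have fbp: "finite (bp a)" for a using Nb by (simp add: bp_def)
  define A where "A = {a \<in> Nb v. card (bp a) \<le> M / 4}"
  have "card (Nb v - A) * (M / 4) \<le> card (Bv v)"
  proof -
    have "card (Nb v - A) * (M / 4) = (\<Sum>a\<in>Nb v - A. M / 4)" by simp
    also have "\<dots> \<le> (\<Sum>a\<in>Nb v - A. real (card (bp a)))"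
      by (rule sum_mono) (auto simp: A_def)
    also have "\<dots> = card (Sigma (Nb v - A) bp)"
      using Nb fbp by (simp add: card_SigmaI)
    also have "\<dots> \<le> card (Bv v)"
      by (intro of_nat_mono card_mono) (use fbad in \<open>auto simp: Bv_def bp_def\<close>)
    finally show ?thesis .
  qed
  also have "\<dots> \<le> M\<^sup>2 / 8" by (rule badv)
  also have "\<dots> = M / 2 * (M / 4)" by (simp add: power2_eq_square)
  finally have "card (Nb v - A) * (M / 4) \<le> M / 2 * (M / 4)" .
  then have "real (card (Nb v - A)) \<le> M / 2" by (rule mult_right_le_imp_le) (use Mpos in simp)
  moreover have "real (card (Nb v - A)) = M - card A"
    using Nb by (subst card_Diff_subset) (auto simp: A_def M_def intro!: of_nat_diff card_mono)
  ultimately have cA: "card A \<ge> M / 2" by simp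
  show ?thesis
  proof (rule that[of A])
    show "A \<subseteq> V" using Nb by (auto simp: A_def)
    show "card A \<ge> \<delta> / 4 * card V" using cA M by (simp add: N_def)
  next
    fix a a' assume a: "a \<in> A" "a' \<in> A"
    define G where "G = Nb v - bp a - bp a'"
    have fG: "finite G" using Nb by (simp add: G_def)
    have "M - card (bp a) - card (bp a') \<le> card G"
    proof -
      have "card (Nb v) \<le> card (G \<union> (bp a \<union> bp a'))"
        by (rule card_mono) (use fG fbp in \<open>auto simp: G_def\<close>)
      also have "\<dots> \<le> card G + (card (bp a) + card (bp a'))"
        by (meson card_Un_le le_trans add_left_mono)
      finally show ?thesis by (simp add: M_def)
    qed
    then have cG: "card G \<ge> \<delta> / 4 * N" using a M by (simp add: A_def)
    have good: "card (Nb a \<inter> Nb b) \<ge> \<theta> * N" "card (Nb a' \<inter> Nb b) \<ge> \<theta> * N" if "b \<in> G" for b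
      using that a Nb by (auto simp: G_def bp_def bad_def A_def)
    let ?W = "{(x, b, y). (a, x) \<in> R \<and> (x, b) \<in> R \<and> (b, y) \<in> R \<and> (y, a') \<in> R}"
    let ?S = "Sigma G (\<lambda>b. (Nb a \<inter> Nb b) \<times> (Nb a' \<inter> Nb b))"
    have fW: "finite ?W" by (rule finite_subset[of _ "V \<times> V \<times> V"]) (use V inV in auto)
    have "\<delta> / 4 * \<theta>\<^sup>2 * N ^ 3 = \<delta> / 4 * N * ((\<theta> * N) * (\<theta> * N))"
      by (simp add: power2_eq_square power3_eq_cube)
    also have "\<dots> \<le> card G * ((\<theta> * N) * (\<theta> * N))"
      using cG \<theta> N by (intro mult_right_mono) auto
    also have "\<dots> = (\<Sum>b\<in>G. (\<theta> * N) * (\<theta> * N))" by simp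
    also have "\<dots> \<le> (\<Sum>b\<in>G. real (card (Nb a \<inter> Nb b)) * real (card (Nb a' \<inter> Nb b)))"
      using good \<theta> N by (intro sum_mono mult_mono) auto
    also have "\<dots> = card ?S"
      using fG Nb by (simp add: card_SigmaI card_cartesian_product)
    also have "\<dots> \<le> card ?W"
    proof (intro of_nat_mono card_inj_on_le[where f = "\<lambda>(b, x, y). (x, b, y)"])
      show "inj_on (\<lambda>(b, x, y). (x, b, y)) ?S" by (auto simp: inj_on_def)
      show "(\<lambda>(b, x, y). (x, b, y)) ` ?S \<subseteq> ?W" using symR by (auto simp: Nb_def)
    qed (rule fW)
    finally show "card ?W \<ge> \<delta> / 4 * \<theta>\<^sup>2 * real (card V) ^ 3" by (simp add: N_def)
  qed
qed

section \<open>Additive energy and graphs of injections\<close>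

text \<open>A form of the Balog--Szemeredi--Gowers theorem. Join \<open>u\<close> and \<open>v\<close> when \<open>u - v\<close> is a popular
difference of \<open>\<Gamma>\<close>; large energy makes this graph dense. For \<open>a\<close>, \<open>a'\<close> in the set provided by
\<open>dense_graph_many_walks\<close>, each walk from \<open>a\<close> to \<open>a'\<close> writes \<open>a - a'\<close> as a sum of four popular
differences, hence in many ways as a signed sum of eight elements of \<open>\<Gamma>\<close>. There are only
\<open>card \<Gamma> ^ 8\<close> such sums, so few differences \<open>a - a'\<close> can occur.\<close>
lemma additive_energy_small_difference_set:
  fixes \<Gamma> :: "'a::ab_group_add set" and c :: real
  assumes \<Gamma>: "finite \<Gamma>" and c: "c > 0"
    and energy: "card {(u, v, x, y) \<in> \<Gamma> \<times> \<Gamma> \<times> \<Gamma> \<times> \<Gamma>. u - v = x - y} \<ge> c * real (card \<Gamma>) ^ 3"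
  obtains A where "A \<subseteq> \<Gamma>" "card A \<ge> c / 8 * card \<Gamma>"
    "c ^ 9 / 2 ^ 19 * real (card ((\<lambda>(a, b). a - b) ` (A \<times> A))) \<le> card \<Gamma>"
proof (cases "\<Gamma> = {}")
  case True
  then show ?thesis using that[of "{}"] by auto
next
  case False
  define N where "N = real (card \<Gamma>)"
  have N: "N > 0" using False \<Gamma> by (simp add: N_def card_gt_0_iff)
  define rep where "rep d = {(u, v) \<in> \<Gamma> \<times> \<Gamma>. u - v = d}" for d
  have frep: "finite (rep d)" for d
    unfolding rep_def by (rule finite_subset[of _ "\<Gamma> \<times> \<Gamma>"]) (use \<Gamma> in auto)
  have rep_le: "real (card (rep d)) \<le> N" for d
  proof -
    have "card (rep d) \<le> card \<Gamma>"
      by (rule card_inj_on_le[where f=fst]) (use \<Gamma> in \<open>auto simp: rep_def inj_on_def\<close>)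
    then show ?thesis by (simp add: N_def)
  qed
  have rep_minus: "card (rep (u - v)) = card (rep (v - u))" for u v
    by (rule bij_betw_same_card[where f=prod.swap], rule bij_betwI[where g=prod.swap])
       (auto simp: rep_def algebra_simps)
  define R where "R = {(u, v) \<in> \<Gamma> \<times> \<Gamma>. card (rep (u - v)) \<ge> c / 2 * N}"
  have RG: "R \<subseteq> \<Gamma> \<times> \<Gamma>" by (auto simp: R_def)
  have fR: "finite R" using RG \<Gamma> by (meson finite_SigmaI finite_subset)
  have "sym R" using rep_minus by (auto simp: R_def sym_def)
  have "c * N ^ 3 \<le> card {(u, v, x, y) \<in> \<Gamma> \<times> \<Gamma> \<times> \<Gamma> \<times> \<Gamma>. u - v = x - y}"
    using energy by (simp add: N_def)
  also have "\<dots> = card (Sigma (\<Gamma> \<times> \<Gamma>) (\<lambda>(u, v). rep (u - v)))"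
    by (rule arg_cong[where f=real], rule bij_betw_same_card[where f="\<lambda>(u,v,x,y). ((u,v),(x,y))"],
        rule bij_betwI[where g="\<lambda>((u,v),(x,y)). (u,v,x,y)"]) (auto simp: rep_def)
  also have "\<dots> = (\<Sum>(u, v)\<in>\<Gamma> \<times> \<Gamma>. real (card (rep (u - v))))"
    using \<Gamma> frep by (subst card_SigmaI) (auto simp: case_prod_unfold)
  also have "\<dots> \<le> (\<Sum>p\<in>\<Gamma> \<times> \<Gamma>. N * of_bool (p \<in> R) + c / 2 * N)"
    using rep_le c N by (intro sum_mono) (auto simp: R_def intro: add_increasing2)
  also have "\<dots> = N * card R + c / 2 * N * card (\<Gamma> \<times> \<Gamma>)"
    using \<Gamma> RG by (simp add: sum.distrib sum_distrib_left[symmetric] Int_absorb1 Collect_mem_eq)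
  also have "\<dots> = N * card R + c / 2 * N ^ 3"
    by (simp add: card_cartesian_product N_def power3_eq_cube)
  finally have "c * N ^ 3 \<le> N * card R + c / 2 * N ^ 3" .
  moreover have "N * (c / 2 * N\<^sup>2) = c * N ^ 3 - c / 2 * N ^ 3"
    by (simp add: power2_eq_square power3_eq_cube)
  ultimately have "N * (c / 2 * N\<^sup>2) \<le> N * card R" by linarith
  then have dense: "card R \<ge> c / 2 * real (card \<Gamma>) ^ 2" using N by (simp add: N_def)
  obtain A where A: "A \<subseteq> \<Gamma>" "card A \<ge> c / 2 / 4 * card \<Gamma>"
    and walks: "\<And>a a'. a \<in> A \<Longrightarrow> a' \<in> A \<Longrightarrow>
       card {(x, b, y). (a, x) \<in> R \<and> (x, b) \<in> R \<and> (b, y) \<in> R \<and> (y, a') \<in> R}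
         \<ge> c / 2 / 4 * ((c / 2)\<^sup>2 / 16)\<^sup>2 * real (card \<Gamma>) ^ 3"
    using dense_graph_many_walks[OF \<Gamma> RG \<open>sym R\<close> _ dense] c by auto
  have fA: "finite A" using A \<Gamma> finite_subset by blast
  let ?D = "(\<lambda>(a, b). a - b) ` (A \<times> A)"
  let ?P = "\<Gamma> \<times> \<Gamma>"
  let ?T = "?P \<times> ?P \<times> ?P \<times> ?P"
  let ?F = "\<lambda>((e1, f1), (e2, f2), (e3, f3), (e4, f4)). (e1 - f1) + (e2 - f2) + (e3 - f3) + (e4 - f4) :: 'a"
  \<comment> \<open>Walks of length four, times the representations of each of their four steps.\<close>
  define m where "m = c ^ 5 / 2 ^ 15 * N ^ 3 * (c / 2 * N) ^ 4"
  have "card ?D * m \<le> card ?T"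
  proof (rule card_times_fibre_le[where F = ?F])
    fix d assume "d \<in> ?D"
    then obtain a a' where a: "a \<in> A" "a' \<in> A" "d = a - a'" by auto
    let ?W = "{(x, b, y). (a, x) \<in> R \<and> (x, b) \<in> R \<and> (b, y) \<in> R \<and> (y, a') \<in> R}"
    have fW: "finite ?W"
      by (rule finite_subset[of _ "\<Gamma> \<times> \<Gamma> \<times> \<Gamma>"]) (use \<Gamma> RG in auto)
    let ?Q = "\<lambda>(x, b, y). rep (a - x) \<times> rep (x - b) \<times> rep (b - y) \<times> rep (y - a')"
    have big: "real (card (rep (u - v))) \<ge> c / 2 * N" if "(u, v) \<in> R" for u v
      using that by (simp add: R_def)
    have "m = c / 2 / 4 * ((c / 2)\<^sup>2 / 16)\<^sup>2 * N ^ 3 * (c / 2 * N) ^ 4"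
      unfolding m_def by (simp add: power_divide power_mult_distrib flip: power_mult)
        (simp add: power_numeral_reduce)
    also have "\<dots> \<le> card ?W * (c / 2 * N) ^ 4"
      using walks[OF a(1,2)] c N by (intro mult_right_mono) (auto simp: N_def)
    also have "\<dots> = (\<Sum>w\<in>?W. (c / 2 * N) * ((c / 2 * N) * ((c / 2 * N) * (c / 2 * N))))"
      by (simp add: power4_eq_xxxx)
    also have "\<dots> \<le> (\<Sum>w\<in>?W. real (card (?Q w)))"
      using c N by (intro sum_mono) (auto simp only: card_cartesian_product of_nat_mult split: prod.splits
         intro!: mult_mono big mult_nonneg_nonneg)
    also have "\<dots> = card (Sigma ?W ?Q)"
      using fW frep by (subst card_SigmaI) auto
    also have "\<dots> \<le> card {t \<in> ?T. ?F t = d}"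
    proof (intro of_nat_mono card_inj_on_le[where f = snd])
      show "inj_on snd (Sigma ?W ?Q)"
      proof (rule inj_onI)
        fix s t assume *: "s \<in> Sigma ?W ?Q" "t \<in> Sigma ?W ?Q" "snd s = snd t"
        obtain x b y q\<^sub>1 q\<^sub>2 q\<^sub>3 q\<^sub>4 where s: "s = ((x, b, y), (q\<^sub>1, q\<^sub>2, q\<^sub>3, q\<^sub>4))"
          by (cases s) auto
        obtain x' b' y' where t: "t = ((x', b', y'), snd s)" using *(3) by (cases t) auto
        have q: "a - x = fst q\<^sub>1 - snd q\<^sub>1" "a - x' = fst q\<^sub>1 - snd q\<^sub>1"
          "x - b = fst q\<^sub>2 - snd q\<^sub>2" "x' - b' = fst q\<^sub>2 - snd q\<^sub>2"
          "b - y = fst q\<^sub>3 - snd q\<^sub>3" "b' - y' = fst q\<^sub>3 - snd q\<^sub>3"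
          using *(1,2) unfolding s t rep_def by (auto simp: case_prod_unfold)
        have "x = x'" using q(1,2) by (metis diff_left_imp_eq)
        moreover from this have "b = b'" using q(3,4) by (metis diff_left_imp_eq)
        moreover from this have "y = y'" using q(5,6) by (metis diff_left_imp_eq)
        ultimately show "s = t" by (simp add: s t)
      qed
      show "snd ` Sigma ?W ?Q \<subseteq> {t \<in> ?T. ?F t = d}"
        unfolding rep_def a(3) by clarsimp
      show "finite {t \<in> ?T. ?F t = d}"
        by (rule finite_subset[of _ ?T]) (use \<Gamma> in auto)
    qed
    finally show "m \<le> card {t \<in> ?T. ?F t = d}" .
  qed (use \<Gamma> fA in auto)
  also have "card ?T = N ^ 8" by (simp add: card_cartesian_product N_def power_numeral_reduce)
  also have "card ?D * m = c ^ 9 / 2 ^ 19 * card ?D * N ^ 7"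
    by (simp add: m_def power_divide power_mult_distrib power_numeral_reduce)
  finally have "c ^ 9 / 2 ^ 19 * card ?D * N ^ 7 \<le> N * N ^ 7" by (simp add: power_numeral_reduce)
  then have "c ^ 9 / 2 ^ 19 * card ?D \<le> N"
    by (rule mult_right_le_imp_le) (use N in simp)
  then show ?thesis using that[OF A(1)] A(2) by (simp add: N_def)
qed

text \<open>If \<open>A\<close> has few differences, at least half of the pairs in \<open>A\<close> have a popular difference, so some
\<open>b\<^sub>0\<close> has popular differences with half of \<open>A\<close>. For a popular difference \<open>d\<close>, regrouping
\<open>a + (u - v) + (u' - v')\<close>, with \<open>u - v\<close> and \<open>u' - v'\<close> two representations of \<open>d\<close>, as a sum of two
differences and one element of \<open>A\<close> shows that \<open>a + 2d\<close> has many representations by triples taken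
from a set of size \<open>O(card A ^ 3)\<close>. This replaces the Pluennecke inequality for threefold sums.\<close>
lemma small_difference_set_many_doubled_translates:
  fixes A :: "'a::ab_group_add set" and K :: real
  assumes A: "finite A" "A \<noteq> {}" and K: "K > 0"
    and small: "card ((\<lambda>(a, b). a - b) ` (A \<times> A)) \<le> K * card A"
  obtains b\<^sub>0 B where "B \<subseteq> A" "card B \<ge> card A / 2"
    "card ((\<lambda>(a, b). a + (b\<^sub>0 - b) + (b\<^sub>0 - b)) ` (A \<times> B)) \<le> 4 * K ^ 4 * card A"
proof -
  define N where "N = real (card A)"
  have N: "N > 0" using A by (simp add: N_def card_gt_0_iff)
  let ?D = "(\<lambda>(a, b). a - b) ` (A \<times> A)"
  have fD: "finite ?D" using A by simp
  define rep where "rep d = {(u, v) \<in> A \<times> A. u - v = d}" for d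
  have frep: "finite (rep d)" for d
    unfolding rep_def by (rule finite_subset[of _ "A \<times> A"]) (use A in auto)
  define \<tau> where "\<tau> = N / (2 * K)"
  have \<tau>: "\<tau> > 0" using N K by (simp add: \<tau>_def)
  define L where "L = {d \<in> ?D. card (rep d) < \<tau>}"
  define nb where "nb u = {v \<in> A. card (rep (u - v)) \<ge> \<tau>}" for u
  have fnb: "finite (nb u)" for u using A by (simp add: nb_def)
  have "real (card (\<Union>d\<in>L. rep d)) \<le> (\<Sum>d\<in>L. real (card (rep d)))"
    using card_UN_le[of L rep] fD by (simp add: L_def flip: of_nat_sum)
  also have "\<dots> \<le> (\<Sum>d\<in>L. \<tau>)" by (rule sum_mono) (simp add: L_def)
  also have "\<dots> = card L * \<tau>" by simp
  also have "\<dots> \<le> card ?D * \<tau>"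
    using \<tau> fD by (intro mult_right_mono of_nat_mono card_mono) (auto simp: L_def)
  also have "\<dots> \<le> K * N * \<tau>" using small \<tau> by (intro mult_right_mono) (auto simp: N_def)
  also have "\<dots> = N * (N / 2)" using K by (simp add: \<tau>_def)
  finally have unpopular: "real (card (\<Union>d\<in>L. rep d)) \<le> N * (N / 2)" .
  have "N * N = card (A \<times> A)" by (simp add: card_cartesian_product N_def)
  also have "\<dots> \<le> card (Sigma A nb \<union> (\<Union>d\<in>L. rep d))"
    by (intro of_nat_mono card_mono) (use A fD frep fnb in \<open>auto simp: L_def nb_def rep_def\<close>)
  also have "\<dots> \<le> real (card (Sigma A nb)) + real (card (\<Union>d\<in>L. rep d))"
    unfolding of_nat_add[symmetric] by (intro of_nat_mono card_Un_le)
  also have "real (card (Sigma A nb)) = (\<Sum>u\<in>A. real (card (nb u)))"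
    using A fnb by (simp add: card_SigmaI)
  finally have sum: "N * (N / 2) \<le> (\<Sum>u\<in>A. real (card (nb u)))"
    using unpopular by simp
  have "\<exists>u\<in>A. card (nb u) \<ge> N / 2"
  proof (rule ccontr)
    assume "\<not> ?thesis"
    then have "(\<Sum>u\<in>A. real (card (nb u))) < (\<Sum>u\<in>A. N / 2)"
      using A by (intro sum_strict_mono) auto
    with sum show False by (simp add: N_def)
  qed
  then obtain b\<^sub>0 where b0: "b\<^sub>0 \<in> A" "card (nb b\<^sub>0) \<ge> N / 2" by blast
  let ?X = "(\<lambda>(a, b). a + (b\<^sub>0 - b) + (b\<^sub>0 - b)) ` (A \<times> nb b\<^sub>0)"
  let ?T = "?D \<times> ?D \<times> A"
  let ?F = "\<lambda>(p, q, z). p + q + z :: 'a"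
  have "card ?X * (\<tau> * \<tau>) \<le> card ?T"
  proof (rule card_times_fibre_le[where F = ?F])
    fix x assume "x \<in> ?X"
    then obtain a b where ab: "a \<in> A" "b \<in> nb b\<^sub>0" "x = a + (b\<^sub>0 - b) + (b\<^sub>0 - b)" by auto
    let ?R = "rep (b\<^sub>0 - b)"
    let ?f = "\<lambda>(p, q). (a - snd p, fst p - snd q, fst q)"
    have R: "fst p \<in> A" "snd p \<in> A" "fst p - snd p = b\<^sub>0 - b" if "p \<in> ?R" for p
      using that by (auto simp: rep_def)
    have "\<tau> * \<tau> \<le> card (?R \<times> ?R)"
      using ab \<tau> by (auto simp: card_cartesian_product nb_def intro!: mult_mono)
    also have "\<dots> \<le> card {t \<in> ?T. ?F t = x}"
    proof (intro of_nat_mono card_inj_on_le[where f = ?f])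
      show "inj_on ?f (?R \<times> ?R)"
      proof (rule inj_onI)
        fix s t assume *: "s \<in> ?R \<times> ?R" "t \<in> ?R \<times> ?R" "?f s = ?f t"
        have "fst p - snd p = fst q - snd q" if "p \<in> ?R" "q \<in> ?R" for p q
          using that by (simp add: R(3))
        from this[of "fst s" "fst t"] this[of "snd s" "snd t"]
        have "fst (fst s) - snd (fst s) = fst (fst t) - snd (fst t)"
          "fst (snd s) - snd (snd s) = fst (snd t) - snd (snd t)"
          using *(1,2) by (simp_all add: mem_Times_iff)
        moreover from *(3) have "snd (fst s) = snd (fst t)" "fst (snd s) = fst (snd t)"
          "fst (fst s) - snd (snd s) = fst (fst t) - snd (snd t)"
          by (simp_all add: case_prod_unfold)
        ultimately show "s = t" by (simp add: prod_eq_iff)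
      qed
      show "?f ` (?R \<times> ?R) \<subseteq> {t \<in> ?T. ?F t = x}"
      proof (rule image_subsetI)
        fix s assume "s \<in> ?R \<times> ?R"
        then obtain p q where s: "s = (p, q)" and p: "p \<in> ?R" and q: "q \<in> ?R" by blast
        have "(a - snd p) + (fst p - snd q) + fst q = a + (fst p - snd p) + (fst q - snd q)"
          by (simp add: algebra_simps)
        also have "\<dots> = x" by (simp only: R(3)[OF p] R(3)[OF q] ab(3))
        finally show "?f s \<in> {t \<in> ?T. ?F t = x}"
          using R(1,2)[OF p] R(1,2)[OF q] ab(1) by (simp add: s image_iff) blast
      qed
      show "finite {t \<in> ?T. ?F t = x}" by (rule finite_subset[of _ ?T]) (use A in auto)
    qed
    finally show "\<tau> * \<tau> \<le> card {t \<in> ?T. ?F t = x}" .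
  qed (use A fnb fD in auto)
  also have "real (card ?T) \<le> (K * N) * ((K * N) * N)"
    unfolding card_cartesian_product of_nat_mult
    using small K N by (intro mult_mono) (auto simp: N_def)
  also have "\<dots> = 4 * K ^ 4 * N * (\<tau> * \<tau>)"
    using K by (simp add: \<tau>_def power4_eq_xxxx)
  finally have "card ?X \<le> 4 * K ^ 4 * N"
    by (rule mult_right_le_imp_le) (use \<tau> in simp)
  then show ?thesis using that[of "nb b\<^sub>0" b\<^sub>0] b0 by (auto simp: N_def nb_def)
qed

text \<open>The contradiction between large energy and injectivity. Doubling kills the second coordinate, so
\<open>a + 2(b\<^sub>0 - b)\<close> has the second coordinate of \<open>a\<close>, which determines \<open>a\<close>; its first coordinate
then determines the first coordinate of \<open>b\<close>, and hence \<open>b\<close>. So these elements number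
\<open>card A * card B\<close>, of order \<open>card A ^ 2\<close>, although there are only \<open>O(card A)\<close> of them. This bounds
\<open>card A\<close>, and thereby \<open>card \<Gamma>\<close>, in terms of \<open>c\<close> alone.\<close>
lemma additive_energy_graph_exponent_two:
  fixes \<Gamma> :: "(int \<times> 'b::ab_group_add) set" and c :: real
  assumes \<Gamma>: "finite \<Gamma>" and c: "c > 0"
    and inj: "inj_on fst \<Gamma>" "inj_on snd \<Gamma>" and two: "\<And>x::'b. x + x = 0"
    and energy: "card {(u, v, x, y) \<in> \<Gamma> \<times> \<Gamma> \<times> \<Gamma> \<times> \<Gamma>. u - v = x - y} \<ge> c * real (card \<Gamma>) ^ 3"
  shows "real (card \<Gamma>) \<le> (64 / c) * (2 ^ 22 / c ^ 10) ^ 4"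
proof (cases "\<Gamma> = {}")
  case True
  then show ?thesis using c by simp
next
  case False
  define N where "N = real (card \<Gamma>)"
  have N: "N > 0" using False \<Gamma> by (simp add: N_def card_gt_0_iff)
  obtain A where A: "A \<subseteq> \<Gamma>" "card A \<ge> c / 8 * card \<Gamma>"
    "c ^ 9 / 2 ^ 19 * real (card ((\<lambda>(a, b). a - b) ` (A \<times> A))) \<le> card \<Gamma>"
    by (rule additive_energy_small_difference_set[OF \<Gamma> c energy])
  have fA: "finite A" using A \<Gamma> finite_subset by blast
  have "0 < c / 8 * N" using c N by simp
  also have "\<dots> \<le> card A" using A(2) by (simp add: N_def)
  finally have cA: "real (card A) > 0" .
  then have A0: "A \<noteq> {}" by auto
  define K where "K = 2 ^ 22 / c ^ 10"
  have K: "K > 0" using c by (simp add: K_def)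
  have "card ((\<lambda>(a, b). a - b) ` (A \<times> A)) \<le> 2 ^ 19 / c ^ 9 * N"
    using A(3) c by (simp add: field_simps N_def)
  also have "\<dots> \<le> 2 ^ 19 / c ^ 9 * (8 / c * card A)"
    using A(2) c by (intro mult_left_mono) (auto simp: field_simps N_def)
  also have "\<dots> = K * card A" by (simp add: K_def field_simps power_numeral_reduce)
  finally have small: "card ((\<lambda>(a, b). a - b) ` (A \<times> A)) \<le> K * card A" .
  obtain b\<^sub>0 B where B: "B \<subseteq> A" "card B \<ge> card A / 2"
    "card ((\<lambda>(a, b). a + (b\<^sub>0 - b) + (b\<^sub>0 - b)) ` (A \<times> B)) \<le> 4 * K ^ 4 * card A"
    by (rule small_difference_set_many_doubled_translates[OF fA A0 K small])
  have dbl: "snd (a + (b\<^sub>0 - b) + (b\<^sub>0 - b)) = snd a" for a b :: "int \<times> 'b"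
    using two[of "snd b\<^sub>0 - snd b"] by (simp add: add.assoc)
  have "inj_on (\<lambda>(a, b). a + (b\<^sub>0 - b) + (b\<^sub>0 - b)) (A \<times> B)"
  proof (rule inj_onI)
    fix s t assume *: "s \<in> A \<times> B" "t \<in> A \<times> B"
      "(case s of (a, b) \<Rightarrow> a + (b\<^sub>0 - b) + (b\<^sub>0 - b)) = (case t of (a, b) \<Rightarrow> a + (b\<^sub>0 - b) + (b\<^sub>0 - b))"
    obtain a b a' b' where s: "s = (a, b)" and t: "t = (a', b')" by (metis surj_pair)
    have in\<Gamma>: "a \<in> \<Gamma>" "a' \<in> \<Gamma>" "b \<in> \<Gamma>" "b' \<in> \<Gamma>"
      using *(1,2) A(1) B(1) by (auto simp: s t)
    have eq: "a + (b\<^sub>0 - b) + (b\<^sub>0 - b) = a' + (b\<^sub>0 - b') + (b\<^sub>0 - b')" using *(3) by (simp add: s t)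
    have "snd a = snd a'" using arg_cong[OF eq, of snd] by (simp only: dbl)
    then have a: "a = a'" using in\<Gamma> inj(2) by (simp add: inj_on_def)
    have "fst b = fst b'" using arg_cong[OF eq, of fst] by (simp add: a)
    then have "b = b'" using in\<Gamma> inj(1) by (simp add: inj_on_def)
    then show "s = t" by (simp add: s t a)
  qed
  then have "real (card A) * card B \<le> 4 * K ^ 4 * card A"
    using B(3) by (simp add: card_image card_cartesian_product)
  then have "real (card B) \<le> 4 * K ^ 4" using cA by (simp add: mult.commute)
  then have "card A \<le> 8 * K ^ 4" using B(2) by linarith
  then have "c / 8 * N \<le> 8 * K ^ 4" using A(2) by (simp add: N_def)
  then show ?thesis using c by (simp add: K_def N_def field_simps)
qed

section \<open>Characters of the dyadic group and Walsh kernels\<close>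

text \<open>The pairing \<open>(-1) ^ (\<Sum>i<n. j\<^sub>i s\<^sub>i)\<close> of binary digits: the value of the \<open>j\<close>-th Walsh function
on a dyadic interval of length \<open>2 ^ -n\<close>, indexed by the bit-reversal \<open>s\<close> of its position. The
product form makes symmetry and multiplicativity visible digit by digit.\<close>
definition character :: "nat \<Rightarrow> nat \<Rightarrow> nat \<Rightarrow> real" where
  "character n j s = (\<Prod>i<n. if bit j i \<and> bit s i then - 1 else 1)"

lemma character_sym: "character n j s = character n s j"
  by (simp add: character_def conj_commute)

lemma character_xor: "character n (j \<oplus> k) s = character n j s * character n k s"
  unfolding character_def prod.distrib[symmetric]
  by (rule prod.cong) (auto simp: bit_xor_iff)

lemma character_nonzero: "character n j s \<noteq> 0"
  by (simp add: character_def)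

lemma character_self: "character n j s * character n j s = 1"
  unfolding character_def prod.distrib[symmetric] by (rule prod.neutral) auto

lemma bit_less_exp: "bit j i \<Longrightarrow> j < 2 ^ n \<Longrightarrow> i < n" for i j n :: nat
  using bit_nat_iff by (metis bit_take_bit_iff take_bit_nat_eq_self_iff)

lemma finite_bits: "finite {i. bit (j::nat) i}"
proof (rule finite_subset)
  show "{i. bit j i} \<subseteq> {..<j}"
    using bit_less_exp[of j _ j] less_exp by auto
qed simp

text \<open>Binary expansion identifies \<open>{..<2 ^ n}\<close> with the subsets of \<open>{..<n}\<close>, and expanding the product
on the right gives one term for each subset.\<close>
lemma sum_subset_products:
  fixes x :: "nat \<Rightarrow> 'a::comm_ring_1"
  shows "(\<Sum>j<2 ^ n. \<Prod>i | bit (j::nat) i. x i) = (\<Prod>i<n. 1 + x i)"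
proof (induction n)
  case 0
  then show ?case by (simp add: lessThan_Suc lessThan_def)
next
  case (Suc n)
  have bits: "{i. bit (2 ^ n + j) i} = insert n {i. bit j i} \<and> n \<notin> {i. bit j i}" if "j < 2 ^ n" for j :: nat
  proof -
    have nb: "\<not> bit j n" using bit_less_exp[of j n n] that by auto
    have "2 ^ n + j = or (2 ^ n) j"
      by (rule disjunctive_add_eq_or, rule bit_eqI) (use nb in \<open>auto simp: bit_and_iff bit_exp_iff\<close>)
    then show ?thesis using nb by (auto simp: bit_or_iff bit_exp_iff)
  qed
  have "(\<Sum>j<k + l. f j) = (\<Sum>j<k. f j) + (\<Sum>j<l. f (k + j))" for f :: "nat \<Rightarrow> 'a" and k l
    by (induction l) (simp_all add: add.assoc)
  from this[where k = "2 ^ n" and l = "2 ^ n"]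
  have "(\<Sum>j<2 ^ Suc n. \<Prod>i | bit (j::nat) i. x i)
      = (\<Sum>j<2 ^ n. \<Prod>i | bit (j::nat) i. x i) + (\<Sum>j<2 ^ n. \<Prod>i | bit (2 ^ n + j :: nat) i. x i)"
    by (simp add: mult_2)
  also have "(\<Sum>j<2 ^ n. \<Prod>i | bit (2 ^ n + j :: nat) i. x i) = (\<Sum>j<2 ^ n. x n * (\<Prod>i | bit (j::nat) i. x i))"
    by (rule sum.cong) (use bits finite_bits in auto)
  also have "\<dots> = x n * (\<Prod>i<n. 1 + x i)" by (simp add: Suc sum_distrib_left[symmetric])
  finally show ?case by (simp add: Suc algebra_simps)
qed

lemma character_eq_subset_product:
  assumes "j < 2 ^ n"
  shows "character n j s = (\<Prod>i | bit j i. if bit s i then - 1 else 1)"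
proof -
  have "{i. bit j i} \<subseteq> {..<n}" using bit_less_exp assms by auto
  then have "(\<Prod>i | bit j i. if bit s i then - 1 else 1 :: real) = (\<Prod>i<n. if i \<in> {i. bit j i} then if bit s i then - 1 else 1 else 1)"
    by (subst prod.inter_restrict[symmetric]) (auto simp: Int_absorb1)
  also have "\<dots> = character n j s" unfolding character_def by (rule prod.cong) auto
  finally show ?thesis by simp
qed

lemma sum_character:
  assumes "j < 2 ^ n"
  shows "(\<Sum>s<2 ^ n. character n j s) = (if j = 0 then 2 ^ n else 0)"
proof -
  have "(\<Sum>s<2 ^ n. character n j s) = (\<Sum>s<2 ^ n. \<Prod>i | bit (s::nat) i. if bit j i then - 1 else 1)"
    by (rule sum.cong) (auto simp: character_sym[of n j] character_eq_subset_product)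
  also have "\<dots> = (\<Prod>i<n. 1 + (if bit j i then - 1 else 1))" by (rule sum_subset_products)
  also have "\<dots> = (if j = 0 then 2 ^ n else 0)"
  proof (cases "j = 0")
    case False
    then obtain i where "bit j i" by (auto simp: bit_eq_iff)
    then show ?thesis using False bit_less_exp[OF _ assms] by (auto intro!: prod_zero)
  qed simp
  finally show ?thesis .
qed

lemma rademacher_abs_le: "\<bar>rademacher i t\<bar> \<le> 1"
  by (simp add: rademacher_def sgn_if)

lemma rademacher_measurable [measurable]: "rademacher i \<in> borel_measurable borel"
  unfolding rademacher_def by measurable

text \<open>Independence of the Rademacher functions. On either half of \<open>[0,1]\<close> the first one is constant and
the others are a rescaled copy of the whole sequence, so the integral factors by induction. The
function \<open>h\<close> is generalised since the induction hypothesis is applied to its shift.\<close>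
lemma has_integral_prod_rademacher:
  fixes h :: "nat \<Rightarrow> real \<Rightarrow> real"
  shows "((\<lambda>t. \<Prod>i<n. h i (rademacher i t)) has_integral (\<Prod>i<n. (h i 1 + h i (- 1)) / 2)) {0..1}"
proof (induction n arbitrary: h)
  case 0
  then show ?case using has_integral_const_real[of 1 0 1] by simp
next
  case (Suc n)
  define g where "g t = (\<Prod>i<n. h (Suc i) (rademacher i t))" for t
  define I where "I = (\<Prod>i<n. (h (Suc i) 1 + h (Suc i) (- 1)) / 2)"
  have g: "(g has_integral I) {0..1}" unfolding g_def I_def by (rule Suc)
  have shift: "rademacher (Suc i) t = rademacher i (2 * t)" "rademacher (Suc i) t = rademacher i (2 * t - 1)" for i t
  proof -
    show "rademacher (Suc i) t = rademacher i (2 * t)" by (simp add: rademacher_def algebra_simps)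
    have per: "sin (x + 2 * real k * pi) = sin x" for x k by (simp add: sin_add)
    have "sin (2 ^ (i + 1) * pi * (2 * t)) = sin (2 ^ (i + 1) * pi * (2 * t - 1) + 2 * real (2 ^ i) * pi)"
      by (simp add: algebra_simps)
    also have "\<dots> = sin (2 ^ (i + 1) * pi * (2 * t - 1))" by (rule per)
    finally show "rademacher (Suc i) t = rademacher i (2 * t - 1)"
      by (simp add: rademacher_def algebra_simps)
  qed
  have split: "(\<Prod>i<Suc n. h i (rademacher i t)) = h 0 (rademacher 0 t) * (\<Prod>i<n. h (Suc i) (rademacher (Suc i) t))" for t
    by (rule prod.lessThan_Suc_shift)
  have left: "((\<lambda>t. \<Prod>i<Suc n. h i (rademacher i t)) has_integral h 0 1 * (I / 2)) {0..1/2}"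
  proof (rule has_integral_spike_finite[where S = "{0, 1/2}" and f = "\<lambda>t. h 0 1 * g (2 * t)"])
    fix t :: real assume "t \<in> {0..1/2} - {0, 1/2}"
    then have "0 < t" "t < 1 / 2" by auto
    then have "sin (2 * pi * t) > 0" by (intro sin_gt_zero) auto
    then have "rademacher 0 t = 1" by (simp add: rademacher_def)
    then show "(\<Prod>i<Suc n. h i (rademacher i t)) = h 0 1 * g (2 * t)"
      by (simp only: split shift(1) g_def)
  next
    have "((\<lambda>t. g (2 * t)) has_integral I / 2) {0..1/2}"
      using has_integral_affinity01[OF g, of 2 0] by simp
    then show "((\<lambda>t. h 0 1 * g (2 * t)) has_integral h 0 1 * (I / 2)) {0..1/2}"
      by (rule has_integral_mult_right)
  qed simp
  have right: "((\<lambda>t. \<Prod>i<Suc n. h i (rademacher i t)) has_integral h 0 (- 1) * (I / 2)) {1/2..1}"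
  proof (rule has_integral_spike_finite[where S = "{1/2, 1}" and f = "\<lambda>t. h 0 (- 1) * g (2 * t - 1)"])
    fix t :: real assume "t \<in> {1/2..1} - {1/2, 1}"
    then have "1 / 2 < t" "t < 1" by auto
    then have "sin (2 * pi * t) < 0" by (intro sin_lt_zero) auto
    then have "rademacher 0 t = - 1" by (simp add: rademacher_def)
    then show "(\<Prod>i<Suc n. h i (rademacher i t)) = h 0 (- 1) * g (2 * t - 1)"
      by (simp only: split shift(2) g_def)
  next
    have "((\<lambda>t. g (2 * t - 1)) has_integral I / 2) {1/2..1}"
      using has_integral_affinity01[OF g, of 2 "- 1"]
      by (simp add: image_affinity_atLeastAtMost_div)
    then show "((\<lambda>t. h 0 (- 1) * g (2 * t - 1)) has_integral h 0 (- 1) * (I / 2)) {1/2..1}"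
      by (rule has_integral_mult_right)
  qed simp
  have "((\<lambda>t. \<Prod>i<Suc n. h i (rademacher i t)) has_integral h 0 1 * (I / 2) + h 0 (- 1) * (I / 2)) {0..1}"
    by (rule has_integral_combine[OF _ _ left right]) auto
  also have "h 0 1 * (I / 2) + h 0 (- 1) * (I / 2) = (\<Prod>i<Suc n. (h i 1 + h i (- 1)) / 2)"
    unfolding prod.lessThan_Suc_shift I_def by (simp add: field_simps)
  finally show ?case .
qed

text \<open>The kernel factors as \<open>\<Prod>i<n. 1 \<plusminus> r\<^sub>i\<close>. It equals \<open>2 ^ n\<close> on a single dyadic interval of length
\<open>2 ^ -n\<close> and vanishes inside the others, so its norm does not depend on the translation \<open>s\<close>.\<close>
lemma Lp_norm_translated_walsh_kernel:
  assumes p: "p > 0"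
  shows "Lp_norm p (\<lambda>t. \<Sum>j<2 ^ n. complex_of_real (character n j s) * complex_of_real (walsh j t))
    = ((2 ^ n) powr (p - 1)) powr (1 / p)"
proof -
  define e where "e i = (if bit s i then - 1 else 1 :: real)" for i
  define F where "F t = (\<Prod>i<n. \<bar>1 + e i * rademacher i t\<bar> powr p)" for t
  have "cmod (\<Sum>j<2 ^ n. complex_of_real (character n j s) * complex_of_real (walsh j t)) powr p = F t" for t
  proof -
    have "(\<Sum>j<2 ^ n. character n j s * walsh j t) = (\<Sum>j<2 ^ n. \<Prod>i | bit (j::nat) i. e i * rademacher i t)"
      by (rule sum.cong) (auto simp: character_eq_subset_product walsh_def e_def prod.distrib)
    also have "\<dots> = (\<Prod>i<n. 1 + e i * rademacher i t)" by (rule sum_subset_products)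
    finally have "cmod (\<Sum>j<2 ^ n. complex_of_real (character n j s) * complex_of_real (walsh j t))
        = (\<Prod>i<n. \<bar>1 + e i * rademacher i t\<bar>)"
      unfolding of_real_mult[symmetric] of_real_sum[symmetric] norm_of_real by (simp add: abs_prod)
    then show ?thesis by (simp add: F_def prod_powr_distrib)
  qed
  moreover have "(F has_integral (\<Prod>i<n. (\<bar>1 + e i * 1\<bar> powr p + \<bar>1 + e i * (- 1)\<bar> powr p) / 2)) {0..1}"
    unfolding F_def by (rule has_integral_prod_rademacher[where h = "\<lambda>i x. \<bar>1 + e i * x\<bar> powr p"])
  moreover have "(\<Prod>i<n. (\<bar>1 + e i * 1\<bar> powr p + \<bar>1 + e i * (- 1)\<bar> powr p) / 2) = (2 ^ n) powr (p - 1)"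
  proof -
    have "(\<Prod>i<n. (\<bar>1 + e i * 1\<bar> powr p + \<bar>1 + e i * (- 1)\<bar> powr p) / 2) = (\<Prod>i<n. 2 powr (p - 1))"
      by (rule prod.cong) (use p in \<open>auto simp: e_def powr_diff\<close>)
    then show ?thesis by (simp add: powr_realpow[symmetric] powr_powr mult.commute)
  qed
  moreover have "set_integrable lborel {0..1} F"
  proof -
    have "F t \<le> (\<Prod>i<n. 2 powr p)" for t
      unfolding F_def
    proof (intro prod_mono conjI powr_mono2)
      fix i
      have "\<bar>e i * rademacher i t\<bar> \<le> 1" using rademacher_abs_le[of i t] by (simp add: e_def)
      then show "\<bar>1 + e i * rademacher i t\<bar> \<le> 2" by linarith
    qed (use p in auto)
    moreover have "F t \<ge> 0" for t by (simp add: F_def prod_nonneg)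
    moreover have "F \<in> borel_measurable borel" unfolding F_def by measurable
    ultimately show ?thesis unfolding set_integrable_def
      by (intro integrableI_bounded_set[where A = "{0..1}" and B = "\<Prod>i<n. 2 powr p"])
         (auto simp: indicator_def)
  qed
  ultimately show ?thesis
    unfolding Lp_norm_def by (simp add: set_borel_integral_eq_integral(2) integral_unique)
qed

section \<open>Moments of trigonometric sums\<close>

lemma trigonometric_eq_cis: "trigonometric n t = cis (2 * pi * real n * t)"
  by (simp add: trigonometric_def cis_conv_exp mult_ac)

lemma has_integral_cos_integer_frequency:
  fixes k :: int
  shows "((\<lambda>t. cos (2 * pi * of_int k * t)) has_integral of_bool (k = 0)) {0..1}"
proof (cases "k = 0")
  case True
  then show ?thesis using has_integral_const_real[of "1::real" 0 1] by simp
next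
  case False
  define w where "w = 2 * pi * real_of_int k"
  have w: "w \<noteq> 0" using False by (simp add: w_def)
  have "((\<lambda>t. cos (w * t)) has_integral (sin (w * 1) / w - sin (w * 0) / w)) {0..1}"
  proof (rule fundamental_theorem_of_calculus)
    fix t :: real
    have "((\<lambda>t. sin (w * t) / w) has_real_derivative cos (w * t)) (at t within {0..1})"
      using w by (auto intro!: derivative_eq_intros)
    then show "((\<lambda>t. sin (w * t) / w) has_vector_derivative cos (w * t)) (at t within {0..1})"
      by (rule has_real_derivative_iff_has_vector_derivative[THEN iffD1])
  qed simp
  moreover have "sin w = 0"
    using sin_int_2pin[of k] by (simp add: w_def)
  ultimately show ?thesis using False by (simp add: w_def)
qed

text \<open>Parseval's identity with repeated frequencies allowed. That generality is what the fourth moment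
needs: the square of a trigonometric sum has one term for each pair of its frequencies.\<close>
lemma has_integral_trigonometric_square:
  fixes a :: "'i \<Rightarrow> real" and \<nu> :: "'i \<Rightarrow> nat"
  assumes "finite I"
  shows "((\<lambda>t. (cmod (\<Sum>i\<in>I. complex_of_real (a i) * trigonometric (\<nu> i) t))\<^sup>2)
    has_integral (\<Sum>i\<in>I. \<Sum>j\<in>I. a i * a j * of_bool (\<nu> i = \<nu> j))) {0..1}"
proof -
  have "(cmod (\<Sum>i\<in>I. complex_of_real (a i) * trigonometric (\<nu> i) t))\<^sup>2
      = (\<Sum>i\<in>I. \<Sum>j\<in>I. a i * a j * cos (2 * pi * of_int (int (\<nu> i) - int (\<nu> j)) * t))" for t
  proof -
    let ?\<theta> = "\<lambda>i. 2 * pi * real (\<nu> i) * t"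
    have "(cmod (\<Sum>i\<in>I. complex_of_real (a i) * trigonometric (\<nu> i) t))\<^sup>2
      = (\<Sum>i\<in>I. a i * cos (?\<theta> i)) * (\<Sum>j\<in>I. a j * cos (?\<theta> j))
        + (\<Sum>i\<in>I. a i * sin (?\<theta> i)) * (\<Sum>j\<in>I. a j * sin (?\<theta> j))"
      unfolding cmod_power2 by (simp add: trigonometric_eq_cis power2_eq_square)
    also have "\<dots> = (\<Sum>i\<in>I. \<Sum>j\<in>I. a i * a j * cos (?\<theta> i - ?\<theta> j))"
      unfolding sum_product sum.distrib[symmetric]
      by (intro sum.cong) (simp_all add: cos_diff algebra_simps)
    finally show ?thesis by (simp add: algebra_simps)
  qed
  moreover have "((\<lambda>t. \<Sum>i\<in>I. \<Sum>j\<in>I. a i * a j * cos (2 * pi * of_int (int (\<nu> i) - int (\<nu> j)) * t))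
      has_integral (\<Sum>i\<in>I. \<Sum>j\<in>I. a i * a j * of_bool (int (\<nu> i) - int (\<nu> j) = 0))) {0..1}"
    by (intro has_integral_sum assms has_integral_mult_right has_integral_cos_integer_frequency)
  ultimately show ?thesis by simp
qed

text \<open>A pointwise substitute for Hoelder's inequality between the exponents \<open>q\<close>, \<open>r\<close> and 4. It covers
\<open>r \<ge> 4\<close> as well, since \<open>y \<le> 1\<close>.\<close>
lemma powr_le_interpolation:
  fixes y \<epsilon> :: real
  assumes "0 \<le> y" "y \<le> 1" "\<epsilon> > 0" "0 < q" "q < r"
  shows "y powr r \<le> \<epsilon> powr (r - q) * y powr q + y ^ 4 / \<epsilon> ^ 4"
proof (cases "y \<le> \<epsilon>")
  case True
  have "y powr r = y powr (r - q) * y powr q" by (simp flip: powr_add)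
  also have "\<dots> \<le> \<epsilon> powr (r - q) * y powr q"
    using True assms by (intro mult_right_mono powr_mono2) auto
  finally show ?thesis using assms by (simp add: add_increasing2)
next
  case False
  have "y powr r \<le> 1" using assms by (simp add: powr_le1)
  also have "1 \<le> y ^ 4 / \<epsilon> ^ 4" using False assms by (simp add: power_mono)
  finally show ?thesis by (simp add: add_increasing)
qed

text \<open>If the moment of order \<open>q\<close> is \<open>O(\<delta>)\<close>, values below a small \<open>\<epsilon>\<close> contribute little to the moment of
higher order \<open>r\<close>. When that moment is nevertheless of order \<open>\<delta>\<close>, it comes from values above
\<open>\<epsilon>\<close>, and these give a fourth moment of the same order.\<close>
lemma fourth_moment_lower_bound:
  fixes g :: "real \<Rightarrow> real"
  assumes g: "continuous_on {0..1} g" "\<And>t. 0 \<le> g t" "\<And>t. g t \<le> 1"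
    and qr: "0 < q" "q < r" and C: "C > 0"
    and lower: "\<delta> / C \<le> integral {0..1} (\<lambda>t. g t powr r)"
    and upper: "integral {0..1} (\<lambda>t. g t powr q) \<le> C * \<delta>"
  shows "((1 / (2 * C\<^sup>2)) powr (1 / (r - q))) ^ 4 / (2 * C) * \<delta> \<le> integral {0..1} (\<lambda>t. g t ^ 4)"
proof -
  \<comment> \<open>With this threshold the values below \<open>\<epsilon>\<close> contribute at most half of the lower bound
    \<open>\<delta> / C\<close> for the moment of order \<open>r\<close>.\<close>
  define \<epsilon> where "\<epsilon> = (1 / (2 * C\<^sup>2)) powr (1 / (r - q))"
  have \<epsilon>: "\<epsilon> > 0" using C by (simp add: \<epsilon>_def)
  have \<epsilon>': "\<epsilon> powr (r - q) = 1 / (2 * C\<^sup>2)" using C qr by (simp add: \<epsilon>_def powr_powr)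
  have int: "(\<lambda>t. g t powr u) integrable_on {0..1}" if "u > 0" for u
    using that g by (intro integrable_continuous_real continuous_on_powr') auto
  have int4: "(\<lambda>t. g t ^ 4) integrable_on {0..1}"
    using g by (intro integrable_continuous_real continuous_intros)
  have "\<delta> / C \<le> integral {0..1} (\<lambda>t. \<epsilon> powr (r - q) * g t powr q + g t ^ 4 / \<epsilon> ^ 4)"
    using lower
  proof (rule order_trans)
    show "integral {0..1} (\<lambda>t. g t powr r)
        \<le> integral {0..1} (\<lambda>t. \<epsilon> powr (r - q) * g t powr q + g t ^ 4 / \<epsilon> ^ 4)"
      by (intro integral_le powr_le_interpolation g \<epsilon> qr int integrable_add integrable_on_mult_right integrable_on_divide int4)
         (use qr in auto)
  qed
  also have "\<dots> = \<epsilon> powr (r - q) * integral {0..1} (\<lambda>t. g t powr q) + integral {0..1} (\<lambda>t. g t ^ 4) / \<epsilon> ^ 4"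
    using int[OF qr(1)] int4 by (subst integral_add) (auto intro: integrable_on_mult_right integrable_on_divide)
  also have "\<epsilon> powr (r - q) * integral {0..1} (\<lambda>t. g t powr q) \<le> 1 / (2 * C\<^sup>2) * (C * \<delta>)"
    unfolding \<epsilon>' using upper by (intro mult_left_mono) auto
  also have "1 / (2 * C\<^sup>2) * (C * \<delta>) = \<delta> / (2 * C)" using C by (simp add: power2_eq_square)
  finally have "\<delta> / C - \<delta> / (2 * C) \<le> integral {0..1} (\<lambda>t. g t ^ 4) / \<epsilon> ^ 4" by simp
  moreover have "\<delta> / C - \<delta> / (2 * C) = \<delta> / (2 * C)" using C by (simp add: field_simps)
  ultimately have "\<delta> / (2 * C) \<le> integral {0..1} (\<lambda>t. g t ^ 4) / \<epsilon> ^ 4" by simp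
  then show ?thesis using \<epsilon> unfolding \<epsilon>_def[symmetric] by (simp add: field_simps)
qed

section \<open>Quadruples additive in both groups\<close>

lemma xor_less_exp: "i < 2 ^ n \<Longrightarrow> j < 2 ^ n \<Longrightarrow> i \<oplus> j < 2 ^ n" for i j :: nat
  by (metis take_bit_nat_eq_self_iff take_bit_xor)

text \<open>Realises bitwise XOR as the addition of an abelian group of exponent two, which makes the group
lemmas applicable.\<close>
definition bit_vector :: "nat \<Rightarrow> nat \<Rightarrow> Z2.bit" where
  "bit_vector j = (\<lambda>i. of_bool (bit j i))"

lemma bit_vector_xor: "bit_vector (j \<oplus> k) = bit_vector j + bit_vector k"
  by (rule ext) (auto simp: bit_vector_def bit_xor_iff)

lemma inj_bit_vector: "inj bit_vector"
proof (rule injI)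
  fix j k assume eq: "bit_vector j = bit_vector k"
  show "j = k"
  proof (rule bit_eqI)
    fix i
    show "bit j i = bit k i" using fun_cong[OF eq, of i] by (auto simp: bit_vector_def split: if_splits)
  qed
qed

text \<open>The quadruples counted are those that are additive in the graph
\<open>\<Gamma> = {(\<tau> j, j) | j < N}\<close> inside the product of the integers with the dyadic group. Both
projections are injective on \<open>\<Gamma>\<close>, so positive energy density bounds \<open>N\<close>.\<close>
lemma few_common_additive_quadruples:
  fixes \<tau> :: "nat \<Rightarrow> nat" and \<kappa> :: real
  assumes \<tau>: "inj \<tau>" and \<kappa>: "\<kappa> > 0"
    and many: "\<kappa> * real N ^ 3
      \<le> card {(i, j, k, l). i < N \<and> j < N \<and> k < N \<and> l < N \<and> \<tau> i + \<tau> j = \<tau> k + \<tau> l \<and> i \<oplus> j = k \<oplus> l}"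
  shows "real N \<le> (64 / \<kappa>) * (2 ^ 22 / \<kappa> ^ 10) ^ 4"
proof -
  define \<gamma> where "\<gamma> j = (int (\<tau> j), bit_vector j)" for j
  define \<Gamma> where "\<Gamma> = \<gamma> ` {..<N}"
  have inj: "inj \<gamma>" using inj_bit_vector by (auto simp: inj_def \<gamma>_def)
  have cG: "card \<Gamma> = N"
    unfolding \<Gamma>_def by (subst card_image) (auto intro: inj_on_subset[OF inj])
  have fG: "finite \<Gamma>" by (simp add: \<Gamma>_def)
  let ?Q = "{(i, j, k, l). i < N \<and> j < N \<and> k < N \<and> l < N \<and> \<tau> i + \<tau> j = \<tau> k + \<tau> l \<and> i \<oplus> j = k \<oplus> l}"
  let ?E = "{(u, v, x, y) \<in> \<Gamma> \<times> \<Gamma> \<times> \<Gamma> \<times> \<Gamma>. u - v = x - y}"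
  have "card ?Q \<le> card ?E"
  proof (rule card_inj_on_le[where f = "\<lambda>(i, j, k, l). (\<gamma> i, \<gamma> k, \<gamma> l, \<gamma> j)"])
    show "inj_on (\<lambda>(i, j, k, l). (\<gamma> i, \<gamma> k, \<gamma> l, \<gamma> j)) ?Q"
      by (auto simp: inj_on_def inj_eq[OF inj])
    show "(\<lambda>(i, j, k, l). (\<gamma> i, \<gamma> k, \<gamma> l, \<gamma> j)) ` ?Q \<subseteq> ?E"
    proof (rule image_subsetI)
      fix q assume "q \<in> ?Q"
      then obtain i j k l where q: "q = (i, j, k, l)" "i < N" "j < N" "k < N" "l < N"
        and add: "\<tau> i + \<tau> j = \<tau> k + \<tau> l" and xor: "i \<oplus> j = k \<oplus> l" by auto
      have "int (\<tau> i) - int (\<tau> k) = int (\<tau> l) - int (\<tau> j)" using add by linarith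
      moreover have "bit_vector i + bit_vector j = bit_vector k + bit_vector l"
        using arg_cong[OF xor, of bit_vector] by (simp only: bit_vector_xor)
      then have "bit_vector i - bit_vector k = bit_vector l - bit_vector j"
        by (metis add_diff_cancel_left' add_diff_cancel_right' diff_add_eq diff_diff_eq2 add.commute)
      ultimately show "(case q of (i, j, k, l) \<Rightarrow> (\<gamma> i, \<gamma> k, \<gamma> l, \<gamma> j)) \<in> ?E"
        using q by (simp add: \<Gamma>_def \<gamma>_def)
    qed
    show "finite ?E" by (rule finite_subset[of _ "\<Gamma> \<times> \<Gamma> \<times> \<Gamma> \<times> \<Gamma>"]) (use fG in auto)
  qed
  then have "real (card ?Q) \<le> real (card ?E)" by (rule of_nat_mono)
  with many have "\<kappa> * real (card \<Gamma>) ^ 3 \<le> card ?E" unfolding cG by (rule order_trans)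
  moreover have "inj_on fst \<Gamma>" "inj_on snd \<Gamma>"
    using \<tau> inj_bit_vector by (auto simp: inj_on_def \<Gamma>_def \<gamma>_def inj_def)
  moreover have "x + x = 0" for x :: "nat \<Rightarrow> Z2.bit" by (rule ext) simp
  ultimately show ?thesis
    using additive_energy_graph_exponent_two[OF fG \<kappa>] by (simp add: cG)
qed

section \<open>Equivalence forces additive quadruples\<close>

text \<open>The trigonometric counterpart of the Walsh kernel translated by \<open>s\<close>, when the system
\<open>w\<^bsub>\<sigma>(k)\<^esub>\<close> corresponds to \<open>e\<^sub>k\<close> and \<open>\<tau>\<close> is the inverse of \<open>\<sigma>\<close>.\<close>
definition twisted_sum :: "(nat \<Rightarrow> nat) \<Rightarrow> nat \<Rightarrow> nat \<Rightarrow> real \<Rightarrow> complex" where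
  "twisted_sum \<tau> n s t = (\<Sum>j<2 ^ n. complex_of_real (character n j s) * trigonometric (\<tau> j) t)"

lemma continuous_twisted_sum: "continuous_on S (twisted_sum \<tau> n s)"
  unfolding twisted_sum_def trigonometric_def by (intro continuous_intros)

lemma norm_twisted_sum_le: "cmod (twisted_sum \<tau> n s t) \<le> 2 ^ n"
proof -
  have "cmod (complex_of_real (character n j s) * trigonometric (\<tau> j) t) = 1" for j
    using character_self[of n j s] by (auto simp: norm_mult trigonometric_eq_cis square_eq_1_iff)
  then show ?thesis unfolding twisted_sum_def
    using norm_sum[of "\<lambda>j. complex_of_real (character n j s) * trigonometric (\<tau> j) t" "{..<2 ^ n}"] by simp
qed

lemma has_integral_twisted_sum_square:
  assumes "inj \<tau>"
  shows "((\<lambda>t. (cmod (twisted_sum \<tau> n s t))\<^sup>2) has_integral 2 ^ n) {0..1}"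
proof -
  have "(\<Sum>i<2 ^ n. \<Sum>j<2 ^ n. character n i s * character n j s * of_bool (\<tau> i = \<tau> j))
      = (\<Sum>i<(2::nat) ^ n. \<Sum>j<2 ^ n. if j = i then 1 else 0 :: real)"
    by (intro sum.cong) (auto simp: inj_eq[OF assms] character_self)
  also have "\<dots> = 2 ^ n" by simp
  finally show ?thesis
    using has_integral_trigonometric_square[of "{..<2 ^ n}" "\<lambda>j. character n j s" \<tau>]
    by (simp add: twisted_sum_def)
qed

text \<open>Integration in \<open>t\<close> selects the quadruples with \<open>\<tau> i + \<tau> j = \<tau> k + \<tau> l\<close>, and summation over \<open>s\<close>
those with \<open>i \<oplus> j = k \<oplus> l\<close>.\<close>
lemma sum_integral_twisted_sum_fourth_power:
  "(\<Sum>s<2 ^ n. integral {0..1} (\<lambda>t. cmod (twisted_sum \<tau> n s t) ^ 4))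
    = 2 ^ n * real (card {(i, j, k, l). i < 2 ^ n \<and> j < 2 ^ n \<and> k < 2 ^ n \<and> l < 2 ^ n \<and>
        \<tau> i + \<tau> j = \<tau> k + \<tau> l \<and> i \<oplus> j = k \<oplus> l})"
proof -
  let ?N = "{..<2 ^ n :: nat}"
  let ?P = "?N \<times> ?N"
  let ?c = "\<lambda>s (i, j). character n i s * character n j s"
  let ?\<nu> = "\<lambda>(i, j). \<tau> i + \<tau> j"
  let ?T = "\<lambda>p q. of_bool (?\<nu> p = ?\<nu> q) :: real"
  have sq: "(twisted_sum \<tau> n s t)\<^sup>2 = (\<Sum>p\<in>?P. complex_of_real (?c s p) * trigonometric (?\<nu> p) t)" for s t
    unfolding twisted_sum_def power2_eq_square sum_product sum.cartesian_product
    by (intro sum.cong) (auto simp: trigonometric_eq_cis cis_mult algebra_simps)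
  have "integral {0..1} (\<lambda>t. cmod (twisted_sum \<tau> n s t) ^ 4) = (\<Sum>p\<in>?P. \<Sum>q\<in>?P. ?c s p * ?c s q * ?T p q)" for s
  proof -
    have "cmod (twisted_sum \<tau> n s t) ^ 4 = (cmod ((twisted_sum \<tau> n s t)\<^sup>2))\<^sup>2" for t
      by (simp add: norm_power flip: power_mult)
    then show ?thesis
      using has_integral_trigonometric_square[of ?P "?c s" ?\<nu>] unfolding sq
      by (simp add: integral_unique)
  qed
  then have "(\<Sum>s<2 ^ n. integral {0..1} (\<lambda>t. cmod (twisted_sum \<tau> n s t) ^ 4))
      = (\<Sum>s<2 ^ n. \<Sum>p\<in>?P. \<Sum>q\<in>?P. ?c s p * ?c s q * ?T p q)" by simp
  also have "\<dots> = (\<Sum>p\<in>?P. \<Sum>q\<in>?P. \<Sum>s<2 ^ n. ?c s p * ?c s q * ?T p q)"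
    by (subst sum.swap, intro sum.cong refl, rule sum.swap)
  also have "\<dots> = (\<Sum>p\<in>?P. \<Sum>q\<in>?P. 2 ^ n * of_bool (?\<nu> p = ?\<nu> q \<and> fst p \<oplus> snd p = fst q \<oplus> snd q))"
  proof (intro sum.cong refl)
    fix p q assume pq: "p \<in> ?P" "q \<in> ?P"
    obtain i j k l where ij: "p = (i, j)" "q = (k, l)" by (metis surj_pair)
    have less: "i \<oplus> j \<oplus> (k \<oplus> l) < 2 ^ n" using pq by (auto simp: ij intro!: xor_less_exp)
    have eq0: "i \<oplus> j \<oplus> (k \<oplus> l) = 0 \<longleftrightarrow> i \<oplus> j = k \<oplus> l"
      by (metis xor.assoc xor.left_neutral xor.right_neutral xor_self_eq)
    have "(\<Sum>s<2 ^ n. ?c s p * ?c s q * ?T p q) = (\<Sum>s<2 ^ n. character n (i \<oplus> j \<oplus> (k \<oplus> l)) s) * ?T p q"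
      by (simp add: ij character_xor sum_distrib_right)
    also have "\<dots> = 2 ^ n * of_bool (?\<nu> p = ?\<nu> q \<and> fst p \<oplus> snd p = fst q \<oplus> snd q)"
      by (simp add: sum_character[OF less] eq0 ij)
    finally show "(\<Sum>s<2 ^ n. ?c s p * ?c s q * ?T p q)
      = 2 ^ n * of_bool (?\<nu> p = ?\<nu> q \<and> fst p \<oplus> snd p = fst q \<oplus> snd q)" .
  qed
  also have "\<dots> = 2 ^ n * (\<Sum>r\<in>?P \<times> ?P. of_bool (case r of (p, q) \<Rightarrow> ?\<nu> p = ?\<nu> q \<and> fst p \<oplus> snd p = fst q \<oplus> snd q))"
    unfolding sum.cartesian_product sum_distrib_left by (intro sum.cong) auto
  also have "(\<Sum>r\<in>?P \<times> ?P. of_bool (case r of (p, q) \<Rightarrow> ?\<nu> p = ?\<nu> q \<and> fst p \<oplus> snd p = fst q \<oplus> snd q) :: real)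
      = card ((?P \<times> ?P) \<inter> {(p, q). ?\<nu> p = ?\<nu> q \<and> fst p \<oplus> snd p = fst q \<oplus> snd q})"
    by (subst sum_of_bool_eq) (auto intro!: arg_cong[where f=card])
  also have "card ((?P \<times> ?P) \<inter> {(p, q). ?\<nu> p = ?\<nu> q \<and> fst p \<oplus> snd p = fst q \<oplus> snd q})
      = card {(i, j, k, l). i < 2 ^ n \<and> j < 2 ^ n \<and> k < 2 ^ n \<and> l < 2 ^ n \<and>
        \<tau> i + \<tau> j = \<tau> k + \<tau> l \<and> i \<oplus> j = k \<oplus> l}"
    by (rule bij_betw_same_card[where f = "\<lambda>((i, j), (k, l)). (i, j, k, l)"],
        rule bij_betwI[where g = "\<lambda>(i, j, k, l). ((i, j), (k, l))"]) auto
  finally show ?thesis .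
qed

lemma Lp_norm_twisted_sum:
  assumes "p > 0"
  shows "Lp_norm p (twisted_sum \<tau> n s) = (integral {0..1} (\<lambda>t. cmod (twisted_sum \<tau> n s t) powr p)) powr (1 / p)"
proof -
  have "continuous_on {0..1} (\<lambda>t. cmod (twisted_sum \<tau> n s t) powr p)"
    using assms by (intro continuous_on_powr' continuous_on_norm continuous_twisted_sum) auto
  then show ?thesis
    unfolding Lp_norm_def
    by (subst set_borel_integral_eq_integral(2)) (auto intro: borel_integrable_atLeastAtMost')
qed

text \<open>The coefficients \<open>character n (\<sigma> k) s\<close> on \<open>{k. \<sigma> k < 2 ^ n}\<close> produce a translated Walsh kernel on
one side, with a known norm, and a twisted trigonometric sum on the other. The constant is
uniform in \<open>s\<close>, which permits averaging over \<open>s\<close> afterwards.\<close>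
lemma equivalence_bounds_twisted_sum:
  assumes \<sigma>: "bij \<sigma>" and p: "p > 0"
    and equiv: "equivalent_in_Lp p trigonometric (\<lambda>k t. complex_of_real (walsh (\<sigma> k) t))"
  obtains C where "C \<ge> 1"
    "\<And>n s. (2 ^ n) powr (p - 1) / C \<le> integral {0..1} (\<lambda>t. cmod (twisted_sum (inv \<sigma>) n s t) powr p)"
    "\<And>n s. integral {0..1} (\<lambda>t. cmod (twisted_sum (inv \<sigma>) n s t) powr p) \<le> C * (2 ^ n) powr (p - 1)"
proof -
  let ?\<tau> = "inv \<sigma>"
  have \<sigma>\<tau>: "\<sigma> (?\<tau> j) = j" "?\<tau> (\<sigma> k) = k" for j k
    using \<sigma> by (simp_all add: bij_is_surj surj_f_inv_f bij_is_inj)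
  have inj: "inj ?\<tau>" using \<sigma> by (simp add: bij_is_surj surj_imp_inj_inv)
  obtain c where c: "c > 0" and eq:
    "\<And>\<xi> :: nat \<Rightarrow> complex. finite {k. \<xi> k \<noteq> 0} \<Longrightarrow>
        1 / c * Lp_norm p (\<lambda>t. \<Sum>k | \<xi> k \<noteq> 0. \<xi> k * trigonometric k t)
          \<le> Lp_norm p (\<lambda>t. \<Sum>k | \<xi> k \<noteq> 0. \<xi> k * complex_of_real (walsh (\<sigma> k) t)) \<and>
        Lp_norm p (\<lambda>t. \<Sum>k | \<xi> k \<noteq> 0. \<xi> k * complex_of_real (walsh (\<sigma> k) t))
          \<le> c * Lp_norm p (\<lambda>t. \<Sum>k | \<xi> k \<noteq> 0. \<xi> k * trigonometric k t)"
    using equiv unfolding equivalent_in_Lp_def by blast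
  have both: "1 / c * Lp_norm p (twisted_sum ?\<tau> n s) \<le> ((2 ^ n) powr (p - 1)) powr (1 / p)"
    "((2 ^ n) powr (p - 1)) powr (1 / p) \<le> c * Lp_norm p (twisted_sum ?\<tau> n s)" for n s
  proof -
    define \<xi> where "\<xi> k = (if \<sigma> k < 2 ^ n then complex_of_real (character n (\<sigma> k) s) else 0)" for k
    have supp: "{k. \<xi> k \<noteq> 0} = ?\<tau> ` {..<2 ^ n}"
      by (force simp: \<xi>_def character_nonzero \<sigma>\<tau> image_iff)
    have sum: "(\<Sum>k | \<xi> k \<noteq> 0. \<xi> k * a k) = (\<Sum>j<2 ^ n. complex_of_real (character n j s) * a (?\<tau> j))"
      for a :: "nat \<Rightarrow> complex"
      unfolding supp by (subst sum.reindex) (auto simp: \<xi>_def \<sigma>\<tau> inj_on_subset[OF inj])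
    have fin: "finite {k. \<xi> k \<noteq> 0}" unfolding supp by simp
    have tr: "(\<lambda>t. \<Sum>k | \<xi> k \<noteq> 0. \<xi> k * trigonometric k t) = twisted_sum ?\<tau> n s"
      by (simp add: sum twisted_sum_def fun_eq_iff)
    have wa: "(\<lambda>t. \<Sum>k | \<xi> k \<noteq> 0. \<xi> k * complex_of_real (walsh (\<sigma> k) t))
        = (\<lambda>t. \<Sum>j<2 ^ n. complex_of_real (character n j s) * complex_of_real (walsh j t))"
      by (simp add: sum \<sigma>\<tau>)
    show "1 / c * Lp_norm p (twisted_sum ?\<tau> n s) \<le> ((2 ^ n) powr (p - 1)) powr (1 / p)"
      "((2 ^ n) powr (p - 1)) powr (1 / p) \<le> c * Lp_norm p (twisted_sum ?\<tau> n s)"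
      using eq[OF fin] unfolding tr wa Lp_norm_translated_walsh_kernel[OF p] by blast+
  qed
  define C where "C = max 1 (c powr p)"
  have C: "C \<ge> 1" "c powr p \<le> C" by (auto simp: C_def)
  have root: "A \<le> c powr p * B" if "A powr (1 / p) \<le> c * B powr (1 / p)" "A \<ge> 0" "B \<ge> 0" for A B
  proof -
    have "(A powr (1 / p)) powr p \<le> (c * B powr (1 / p)) powr p"
      using that p c by (intro powr_mono2) auto
    then show ?thesis using that p c by (simp add: powr_powr powr_mult)
  qed
  let ?I = "\<lambda>n s. integral {0..1} (\<lambda>t. cmod (twisted_sum ?\<tau> n s t) powr p)"
  have I: "?I n s \<ge> 0" for n s
    by (rule integral_nonneg)
       (use p in \<open>auto intro!: integrable_continuous_real continuous_on_powr' continuous_on_norm continuous_twisted_sum\<close>)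
  have up: "?I n s \<le> C * (2 ^ n) powr (p - 1)" for n s
  proof -
    have "?I n s powr (1 / p) \<le> c * ((2 ^ n) powr (p - 1)) powr (1 / p)"
      using both(1)[of n s] c unfolding Lp_norm_twisted_sum[OF p] by (simp add: field_simps)
    then have "?I n s \<le> c powr p * (2 ^ n) powr (p - 1)" by (rule root) (use I in auto)
    also have "\<dots> \<le> C * (2 ^ n) powr (p - 1)" using C by (intro mult_right_mono) auto
    finally show ?thesis .
  qed
  have low: "(2 ^ n) powr (p - 1) / C \<le> ?I n s" for n s
  proof -
    have "((2 ^ n) powr (p - 1)) \<le> c powr p * ?I n s"
      using both(2)[of n s] unfolding Lp_norm_twisted_sum[OF p] by (rule root) (use I in auto)
    also have "\<dots> \<le> C * ?I n s" using C I by (intro mult_right_mono) auto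
    finally show ?thesis using C by (simp add: field_simps)
  qed
  show ?thesis by (rule that[OF C(1) low up])
qed

text \<open>For \<open>N = 2 ^ n\<close>, every twisted sum divided by \<open>N\<close> has second moment \<open>1/N\<close> and, under equivalence,
\<open>p\<close>-th moment comparable to \<open>1/N\<close>. As \<open>p \<noteq> 2\<close>, these are two different orders, so the fourth
moment is at least \<open>\<kappa>/N\<close>. Averaging over \<open>s\<close> gives at least \<open>\<kappa> N ^ 3\<close> quadruples additive in
both groups, for every \<open>n\<close>, which \<open>few_common_additive_quadruples\<close> rules out for large \<open>n\<close>.\<close>
theorem trigonometric_not_equivalent_rearranged_walsh:
  assumes \<sigma>: "bij \<sigma>" and p: "p > 0" "p \<noteq> 2"
  shows "\<not> equivalent_in_Lp p trigonometric (\<lambda>k t. complex_of_real (walsh (\<sigma> k) t))"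
proof
  assume "equivalent_in_Lp p trigonometric (\<lambda>k t. complex_of_real (walsh (\<sigma> k) t))"
  then obtain C where C: "C \<ge> 1" and
    low: "\<And>n s. (2 ^ n) powr (p - 1) / C \<le> integral {0..1} (\<lambda>t. cmod (twisted_sum (inv \<sigma>) n s t) powr p)" and
    up: "\<And>n s. integral {0..1} (\<lambda>t. cmod (twisted_sum (inv \<sigma>) n s t) powr p) \<le> C * (2 ^ n) powr (p - 1)"
    using equivalence_bounds_twisted_sum[OF \<sigma> p(1)] by metis
  let ?\<tau> = "inv \<sigma>"
  have inj: "inj ?\<tau>" using \<sigma> by (simp add: bij_is_surj surj_imp_inj_inv)
  define q r where "q = min p 2" and "r = max p 2"
  have qr: "0 < q" "q < r" using p by (auto simp: q_def r_def)
  define \<kappa> where "\<kappa> = ((1 / (2 * C\<^sup>2)) powr (1 / (r - q))) ^ 4 / (2 * C)"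
  have \<kappa>: "\<kappa> > 0" using C by (simp add: \<kappa>_def)
  have fourth: "\<kappa> * (2 ^ n) ^ 3 \<le> integral {0..1} (\<lambda>t. cmod (twisted_sum ?\<tau> n s t) ^ 4)" for n s
  proof -
    define N where "N = (2 ^ n :: real)"
    have N: "N > 0" by (simp add: N_def)
    define g where "g t = cmod (twisted_sum ?\<tau> n s t) / N" for t
    have g: "continuous_on {0..1} g" "0 \<le> g t" "g t \<le> 1" for t
      unfolding g_def using N norm_twisted_sum_le[of ?\<tau> n s t]
      by (auto intro!: continuous_intros continuous_twisted_sum simp: N_def)
    have gu: "integral {0..1} (\<lambda>t. g t powr u)
        = integral {0..1} (\<lambda>t. cmod (twisted_sum ?\<tau> n s t) powr u) / N powr u" for u
      unfolding g_def using N by (simp add: powr_divide)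
    have Np: "N powr (p - 1) / N powr p = 1 / N" using N by (simp add: powr_diff)
    have "integral {0..1} (\<lambda>t. g t powr 2) = 1 / N"
    proof -
      have "integral {0..1} (\<lambda>t. cmod (twisted_sum ?\<tau> n s t) powr 2) = N"
        using integral_unique[OF has_integral_twisted_sum_square[OF inj, of n s]]
        by (simp add: powr_numeral N_def)
      then show ?thesis using N by (simp add: gu powr_numeral power2_eq_square)
    qed
    then have two: "1 / N / C \<le> integral {0..1} (\<lambda>t. g t powr 2)"
      "integral {0..1} (\<lambda>t. g t powr 2) \<le> C * (1 / N)"
      using C N by (simp_all add: field_simps)
    have "1 / N / C \<le> integral {0..1} (\<lambda>t. g t powr p)"
    proof -
      have "1 / N / C = N powr (p - 1) / C / N powr p" unfolding Np[symmetric] by simp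
      also have "\<dots> \<le> integral {0..1} (\<lambda>t. g t powr p)"
        unfolding gu using low[of n s] by (intro divide_right_mono) (auto simp: N_def)
      finally show ?thesis .
    qed
    moreover have "integral {0..1} (\<lambda>t. g t powr p) \<le> C * (1 / N)"
    proof -
      have "integral {0..1} (\<lambda>t. g t powr p) \<le> C * N powr (p - 1) / N powr p"
        unfolding gu using up[of n s] by (intro divide_right_mono) (auto simp: N_def)
      also have "\<dots> = C * (1 / N)" unfolding Np[symmetric] by simp
      finally show ?thesis .
    qed
    ultimately have "1 / N / C \<le> integral {0..1} (\<lambda>t. g t powr r)"
      "integral {0..1} (\<lambda>t. g t powr q) \<le> C * (1 / N)"
      using two by (simp_all add: q_def r_def min_def max_def)
    then have "\<kappa> * (1 / N) \<le> integral {0..1} (\<lambda>t. g t ^ 4)"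
      unfolding \<kappa>_def using C by (intro fourth_moment_lower_bound g qr) auto
    also have "\<dots> = integral {0..1} (\<lambda>t. cmod (twisted_sum ?\<tau> n s t) ^ 4) / N ^ 4"
      by (simp add: g_def power_divide)
    finally show ?thesis using N unfolding N_def[symmetric] by (simp add: field_simps power_numeral_reduce)
  qed
  have "2 ^ n \<le> (64 / \<kappa>) * (2 ^ 22 / \<kappa> ^ 10) ^ 4" for n
  proof -
    let ?Q = "{(i, j, k, l). i < 2 ^ n \<and> j < 2 ^ n \<and> k < 2 ^ n \<and> l < 2 ^ n \<and>
        ?\<tau> i + ?\<tau> j = ?\<tau> k + ?\<tau> l \<and> i \<oplus> j = k \<oplus> l}"
    have "2 ^ n * (\<kappa> * (2 ^ n) ^ 3) = (\<Sum>s<(2::nat) ^ n. \<kappa> * (2 ^ n) ^ 3)" by simp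
    also have "\<dots> \<le> (\<Sum>s<2 ^ n. integral {0..1} (\<lambda>t. cmod (twisted_sum ?\<tau> n s t) ^ 4))"
      by (intro sum_mono fourth)
    also have "\<dots> = 2 ^ n * real (card ?Q)" by (rule sum_integral_twisted_sum_fourth_power)
    finally have "\<kappa> * (2 ^ n) ^ 3 \<le> real (card ?Q)" by simp
    then have "real (2 ^ n) \<le> (64 / \<kappa>) * (2 ^ 22 / \<kappa> ^ 10) ^ 4"
      by (intro few_common_additive_quadruples[OF inj \<kappa>]) simp
    then show ?thesis by simp
  qed
  then show False
    using real_arch_pow[of 2 "(64 / \<kappa>) * (2 ^ 22 / \<kappa> ^ 10) ^ 4"] by (meson one_less_numeral_iff semiring_norm(76) not_less)
qed

section \<open>Dyadically linear permutations\<close>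

lemma nat_add_eq_xor_and: "x + y = (x \<oplus> y) + 2 * Bit_Operations.and x y" for x y :: nat
proof (induction x arbitrary: y rule: less_induct)
  case (less x)
  show ?case
  proof (cases "x = 0")
    case False
    then have "x div 2 + y div 2 = (x div 2 \<oplus> y div 2) + 2 * Bit_Operations.and (x div 2) (y div 2)"
      by (intro less) simp
    moreover have "x = x mod 2 + 2 * (x div 2)" "y = y mod 2 + 2 * (y div 2)" by simp_all
    ultimately show ?thesis
      unfolding xor_rec[of x y] and_rec[of x y] by (cases "even x"; cases "even y") (auto elim!: evenE oddE)
  qed simp
qed

text \<open>By \<open>nat_add_eq_xor_and\<close> a sum is its XOR plus twice the carries. So \<open>x + y = z + w\<close> with
\<open>w = x \<oplus> y \<oplus> z\<close> says that \<open>x\<close>, \<open>y\<close> produce the same carries as \<open>z\<close>, \<open>w\<close>, a condition on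
each binary digit separately.\<close>
definition carry_set :: "nat \<Rightarrow> (nat \<times> nat \<times> nat) set" where
  "carry_set n = {(x, y, z). x < 2 ^ n \<and> y < 2 ^ n \<and> z < 2 ^ n \<and>
     Bit_Operations.and x y = Bit_Operations.and z (x \<oplus> y \<oplus> z)}"

text \<open>Six of the eight choices for a digit of \<open>x\<close>, \<open>y\<close>, \<open>z\<close> are admissible: if the digits of \<open>x\<close> and
\<open>y\<close> agree, that of \<open>z\<close> must agree with them, and otherwise it is arbitrary.\<close>
lemma carry_set_card: "finite (carry_set n) \<and> card (carry_set n) \<le> 6 ^ n"
proof (induction n)
  case 0
  have "carry_set 0 = {(0, 0, 0)}" by (auto simp: carry_set_def)
  then show ?case by simp
next
  case (Suc n)
  define B where "B = {(0,0,0), (1,1,1), (0,1,0), (0,1,1), (1,0,0), (1,0,1) :: nat \<times> nat \<times> nat}"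
  have "carry_set (Suc n) \<subseteq> (\<lambda>((x, y, z), (a, b, c)). (2 * x + a, 2 * y + b, 2 * z + c)) ` (carry_set n \<times> B)"
    (is "_ \<subseteq> ?f ` _")
  proof
    fix w assume "w \<in> carry_set (Suc n)"
    then obtain x y z where w: "w = (x, y, z)" and lt: "x < 2 * 2 ^ n" "y < 2 * 2 ^ n" "z < 2 * 2 ^ n"
      and eq: "Bit_Operations.and x y = Bit_Operations.and z (x \<oplus> y \<oplus> z)"
      by (auto simp: carry_set_def)
    have bits: "bit x i \<and> bit y i \<longleftrightarrow> bit z i \<and> ((bit x i \<noteq> bit y i) \<noteq> bit z i)" for i
      using arg_cong[OF eq, of "\<lambda>u. bit u i"] by (simp add: bit_and_iff bit_xor_iff)
    have "Bit_Operations.and (x div 2) (y div 2) = Bit_Operations.and (z div 2) (x div 2 \<oplus> y div 2 \<oplus> z div 2)"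
    proof (rule bit_eqI)
      fix i show "bit (Bit_Operations.and (x div 2) (y div 2)) i
          = bit (Bit_Operations.and (z div 2) (x div 2 \<oplus> y div 2 \<oplus> z div 2)) i"
        using bits[of "Suc i"] by (simp add: bit_and_iff bit_xor_iff bit_Suc)
    qed
    then have "(x div 2, y div 2, z div 2) \<in> carry_set n" using lt by (auto simp: carry_set_def)
    moreover have "(x mod 2, y mod 2, z mod 2) \<in> B"
      using bits[of 0] by (auto simp: B_def bit_0 mod2_eq_if)
    moreover have "w = ?f ((x div 2, y div 2, z div 2), (x mod 2, y mod 2, z mod 2))" by (simp add: w)
    ultimately show "w \<in> ?f ` (carry_set n \<times> B)" by blast
  qed
  moreover have B: "finite B" "card B = 6" by (simp_all add: B_def)
  ultimately have fin: "finite (carry_set (Suc n))"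
    and "card (carry_set (Suc n)) \<le> card (?f ` (carry_set n \<times> B))"
    using Suc by (auto intro: finite_subset card_mono)
  note this(2)
  also have "card (?f ` (carry_set n \<times> B)) \<le> card (carry_set n \<times> B)"
    using Suc B by (intro card_image_le) simp
  also have "\<dots> \<le> 6 ^ Suc n" using Suc B by (simp add: card_cartesian_product)
  finally show ?case using fin by simp
qed

text \<open>For dyadically linear \<open>\<pi>\<close> the defining equation reads \<open>\<pi> (x \<oplus> y \<oplus> z) = \<pi> (x + y - z)\<close>, and
injectivity removes \<open>\<pi>\<close>.\<close>
lemma card_A_set_dyadically_linear:
  assumes "bij \<pi>" "dyadically_linear \<pi>"
  shows "card (A_set \<pi> n) \<le> 6 ^ n"
proof -
  have "A_set \<pi> n \<subseteq> carry_set n"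
  proof (clarsimp simp: A_set_def carry_set_def)
    fix x y z
    assume z: "z \<le> x + y" and eq: "\<pi> x \<oplus> \<pi> y \<oplus> \<pi> z = \<pi> (x + y - z)"
    have "\<pi> (x \<oplus> y \<oplus> z) = \<pi> (x + y - z)"
      using assms(2) eq by (simp add: dyadically_linear_def)
    then have w: "x \<oplus> y \<oplus> z = x + y - z" using assms(1) by (simp add: bij_is_inj inj_eq)
    have "x + y = z + (x \<oplus> y \<oplus> z)" using z w by simp
    also have "\<dots> = (z \<oplus> (x \<oplus> y \<oplus> z)) + 2 * Bit_Operations.and z (x \<oplus> y \<oplus> z)" by (rule nat_add_eq_xor_and)
    also have "z \<oplus> (x \<oplus> y \<oplus> z) = x \<oplus> y" by (metis xor.commute xor.assoc xor_self_eq xor.right_neutral)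
    finally show "Bit_Operations.and x y = Bit_Operations.and z (x \<oplus> y \<oplus> z)"
      using nat_add_eq_xor_and[of x y] by simp
  qed
  then show ?thesis using carry_set_card[of n] by (meson card_mono le_trans)
qed

lemma liminf_dyadically_linear:
  assumes "bij \<pi>" "dyadically_linear \<pi>"
    and small: "(\<lambda>n. real (dyadic_max f n)) \<in> o(\<lambda>n. 4 ^ n / 3 ^ n)"
  shows "liminf (\<lambda>n. ereal (real (card (A_set \<pi> n)) * real (dyadic_max f n) / 8 ^ n)) = 0"
proof -
  have lim: "(\<lambda>n. real (dyadic_max f n) / (4 ^ n / 3 ^ n)) \<longlonglongrightarrow> 0"
    by (rule smalloD_tendsto[OF small])
  have "(\<lambda>n. real (card (A_set \<pi> n)) * real (dyadic_max f n) / 8 ^ n) \<longlonglongrightarrow> 0"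
  proof (rule tendsto_sandwich[OF _ _ tendsto_const lim])
    have "real (card (A_set \<pi> n)) * real (dyadic_max f n) / 8 ^ n \<le> real (dyadic_max f n) / (4 ^ n / 3 ^ n)" for n
    proof -
      have "real (card (A_set \<pi> n)) \<le> real (6 ^ n)"
        by (intro of_nat_mono card_A_set_dyadically_linear assms)
      then have "real (card (A_set \<pi> n)) * real (dyadic_max f n) / 8 ^ n \<le> real (6 ^ n) * real (dyadic_max f n) / 8 ^ n"
        by (intro divide_right_mono mult_right_mono) auto
      also have "\<dots> = real (dyadic_max f n) * (6 ^ n / 8 ^ n)" by simp
      also have "(6 :: real) ^ n / 8 ^ n = 3 ^ n / 4 ^ n" by (simp flip: power_divide)
      also have "real (dyadic_max f n) * (3 ^ n / 4 ^ n) = real (dyadic_max f n) / (4 ^ n / 3 ^ n)" by simp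
      finally show ?thesis .
    qed
    then show "\<forall>\<^sub>F n in sequentially. real (card (A_set \<pi> n)) * real (dyadic_max f n) / 8 ^ n
        \<le> real (dyadic_max f n) / (4 ^ n / 3 ^ n)" by simp
  qed simp
  then have "(\<lambda>n. ereal (real (card (A_set \<pi> n)) * real (dyadic_max f n) / 8 ^ n)) \<longlonglongrightarrow> 0"
    by (simp add: zero_ereal_def)
  then show ?thesis by (intro lim_imp_Liminf) auto
qed

section \<open>Non-equivalence\<close>

theorem theorem5p11:
  fixes \<pi> \<sigma> f :: "nat \<Rightarrow> nat"
  assumes "bij \<pi>" and "bij \<sigma>"
    and "dyadically_differs_by \<pi> \<sigma> f"
  shows "(liminf (\<lambda>n. ereal (real (card (A_set \<pi> n)) * real (dyadic_max f n) / 8 ^ n)) = 0 \<longrightarrow>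
            (\<forall>p::real. 1 < p \<and> p \<noteq> 2 \<longrightarrow>
               \<not> equivalent_in_Lp p trigonometric (\<lambda>k t. complex_of_real (walsh (\<sigma> k) t)))) \<and>
         (dyadically_linear \<pi> \<and>
          (\<lambda>n. real (dyadic_max f n)) \<in> o(\<lambda>n. 4 ^ n / 3 ^ n) \<longrightarrow>
            liminf (\<lambda>n. ereal (real (card (A_set \<pi> n)) * real (dyadic_max f n) / 8 ^ n)) = 0 \<and>
            (\<forall>p::real. 1 < p \<and> p \<noteq> 2 \<longrightarrow>
               \<not> equivalent_in_Lp p trigonometric (\<lambda>k t. complex_of_real (walsh (\<sigma> k) t))))"
  using trigonometric_not_equivalent_rearranged_walsh[OF assms(2)]
    liminf_dyadically_linear[OF assms(1)] by simp

end
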